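(* Let $(X,T)$ be an aperiodic topologically transitive Cantor system and let $C\subset X$ be a discrete cross section. Then the kernel of the homomorphism $\Psi_C\colon\operatorname{Aut}(T_C)\to\mathcal{M}(T)$ is $\langle T_C\rangle$. In particular (taking $C=X$), $\Psi=\Psi_X$ induces an embedding $$\operatorname{Aut}(T)/\langle T\rangle\hookrightarrow\mathcal{M}(T).$$
   Context: A Cantor system $(X,T)$ is a homeomorphism $T\colon X\to X$ of a Cantor set $X$; it is aperiodic if it has no periodic points, and topologically transitive if it has a dense orbit. $\operatorname{Aut}(S)$ denotes the group of self-homeomorphisms of the underlying space commuting with $S$. Mapping class group. The suspension is $\Sigma_T X = X\times\mathbb{R}/\sim$, where $(x,t)\sim(T^n x,t-n)$ for $n\in\mathbb{Z}$, with $\mathbb{R}$-action (flow) $[(x,t)]+s=[(x,t+s)]$, whose orbits are called leaves. $\operatorname{Homeo}^+\Sigma_TX$ is the topological group (uniform topology) of homeomorphisms of $\Sigma_TX$ that map each leaf onto a leaf preserving the orientation given by the flow. Two elements are isotopic if they are joined by a path in $\operatorname{Homeo}^+\Sigma_TX$, and $\mathcal{M}(T)$ is the group of isotopy classes $[f]$. Discrete cross sections. A clopen $C\subset X$ is a discrete cross section if $r_C(x)=\min\{i\ge1: T^i x\in C\}$ is a well-defined continuous function $C\to\mathbb{N}$ and $X=\{T^ix: x\in C,\ i\in\mathbb{N}\}$. The return system is $(C,T_C)$ with $T_C(x)=T^{r_C(x)}x$. For $\varphi\in\operatorname{Aut}(T_C)$, $S_\varphi\in\operatorname{Homeo}^+\Sigma_TX$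 is defined by mapping, for each $x\in C$, the segment $\{[(x,t)]:0\le t\le r_C(x)\}$ linearly onto $\{[(\varphi x,t)]:0\le t\le r_C(\varphi x)\}$, i.e. $[(x,t)]\mapsto[(\varphi x,\,t\,r_C(\varphi x)/r_C(x))]$. Then $\Psi_C(\varphi)=[S_\varphi]$, a well-defined homomorphism. For $C=X$, $\Psi(\varphi)$ is the class of $[(x,t)]\mapsto[(\varphi(x),t)]$. *)

theory Defs
  imports
    "HOL-Analysis.Analysis"
    "HOL-Algebra.Bij"
    "HOL-Algebra.Generated_Groups"
begin

section \<open>Cantor systems\<close>

text \<open>Spaces are abstract topologies and a system on \<open>X\<close> is an arbitrary function that
  restricts to a homeomorphism of \<open>X\<close>; its values outside \<^term>\<open>topspace X\<close> are irrelevant.\<close>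

definition Cantor_set :: "'a topology \<Rightarrow> bool" where
  "Cantor_set X \<longleftrightarrow>
     X homeomorphic_space product_topology (\<lambda>_::nat. discrete_topology (UNIV :: bool set)) UNIV"

definition Cantor_system :: "'a topology \<Rightarrow> ('a \<Rightarrow> 'a) \<Rightarrow> bool" where
  "Cantor_system X T \<longleftrightarrow> Cantor_set X \<and> homeomorphic_map X X T"

definition zpow :: "'a topology \<Rightarrow> ('a \<Rightarrow> 'a) \<Rightarrow> int \<Rightarrow> 'a \<Rightarrow> 'a" where
  "zpow X T n = (if 0 \<le> n then T ^^ nat n else inv_into (topspace X) T ^^ nat (- n))"

definition aperiodic :: "'a topology \<Rightarrow> ('a \<Rightarrow> 'a) \<Rightarrow> bool" where
  "aperiodic X T \<longleftrightarrow> (\<forall>x\<in>topspace X. \<forall>n\<ge>1. (T ^^ n) x \<noteq> x)"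

definition topologically_transitive :: "'a topology \<Rightarrow> ('a \<Rightarrow> 'a) \<Rightarrow> bool" where
  "topologically_transitive X T \<longleftrightarrow>
     (\<exists>x\<in>topspace X. X closure_of range (\<lambda>n. zpow X T n x) = topspace X)"

text \<open>As in \<^const>\<open>BijGroup\<close>, group elements are extensional functions, so that two maps that agree
  on the space are equal.\<close>

definition Aut_group :: "'a topology \<Rightarrow> ('a \<Rightarrow> 'a) \<Rightarrow> ('a \<Rightarrow> 'a) monoid" where
  "Aut_group X S = (BijGroup (topspace X))
     \<lparr>carrier := {f \<in> Bij (topspace X). homeomorphic_map X X f \<and> (\<forall>x\<in>topspace X. f (S x) = S (f x))}\<rparr>"

section \<open>Discrete cross sections\<close>

definition return_time :: "('a \<Rightarrow> 'a) \<Rightarrow> 'a set \<Rightarrow> 'a \<Rightarrow> nat" where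
  "return_time T C x = (LEAST i. 1 \<le> i \<and> (T ^^ i) x \<in> C)"

definition return_map :: "('a \<Rightarrow> 'a) \<Rightarrow> 'a set \<Rightarrow> 'a \<Rightarrow> 'a" where
  "return_map T C = (\<lambda>x\<in>C. (T ^^ return_time T C x) x)"

definition discrete_cross_section :: "'a topology \<Rightarrow> ('a \<Rightarrow> 'a) \<Rightarrow> 'a set \<Rightarrow> bool" where
  "discrete_cross_section X T C \<longleftrightarrow>
     openin X C \<and> closedin X C \<and>
     (\<forall>x\<in>C. \<exists>i\<ge>1. (T ^^ i) x \<in> C) \<and>
     continuous_map (subtopology X C) (discrete_topology UNIV) (return_time T C) \<and>
     topspace X = {(T ^^ i) x |x i. x \<in> C}"

section \<open>The suspension\<close>

definition suspension_rel :: "'a topology \<Rightarrow> ('a \<Rightarrow> 'a) \<Rightarrow> (('a \<times> real) \<times> ('a \<times> real)) set" where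
  "suspension_rel X T = {((x, t), (zpow X T n x, t - of_int n)) |x t n. x \<in> topspace X}"

definition suspension_class :: "'a topology \<Rightarrow> ('a \<Rightarrow> 'a) \<Rightarrow> 'a \<times> real \<Rightarrow> ('a \<times> real) set" where
  "suspension_class X T p = suspension_rel X T `` {p}"

definition suspension :: "'a topology \<Rightarrow> ('a \<Rightarrow> 'a) \<Rightarrow> ('a \<times> real) set topology" where
  "suspension X T = topology (\<lambda>U.
     U \<subseteq> (topspace X \<times> UNIV) // suspension_rel X T \<and>
     openin (prod_topology X euclideanreal) {p \<in> topspace X \<times> UNIV. suspension_class X T p \<in> U})"

lemma openin_suspension:
  "openin (suspension X T) U \<longleftrightarrow>
     U \<subseteq> (topspace X \<times> UNIV) // suspension_rel X T \<and>
     openin (prod_topology X euclideanreal) {p \<in> topspace X \<times> UNIV. suspension_class X T p \<in> U}"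
proof -
  let ?Y = "prod_topology X euclideanreal"
  let ?pre = "\<lambda>U. {p \<in> topspace X \<times> UNIV. suspension_class X T p \<in> U}"
  have "istopology (\<lambda>U. U \<subseteq> (topspace X \<times> UNIV) // suspension_rel X T \<and> openin ?Y (?pre U))"
    unfolding istopology_def
  proof (intro conjI allI impI)
    fix U V
    assume "U \<subseteq> (topspace X \<times> UNIV) // suspension_rel X T \<and> openin ?Y (?pre U)"
      and "V \<subseteq> (topspace X \<times> UNIV) // suspension_rel X T \<and> openin ?Y (?pre V)"
    moreover have "?pre (U \<inter> V) = ?pre U \<inter> ?pre V" by auto
    ultimately show "U \<inter> V \<subseteq> (topspace X \<times> UNIV) // suspension_rel X T" "openin ?Y (?pre (U \<inter> V))"
      by (auto intro: openin_Int)
  next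
    fix K
    assume K: "\<forall>U\<in>K. U \<subseteq> (topspace X \<times> UNIV) // suspension_rel X T \<and> openin ?Y (?pre U)"
    then show "\<Union>K \<subseteq> (topspace X \<times> UNIV) // suspension_rel X T" by auto
    have "?pre (\<Union>K) = \<Union>(?pre ` K)" by auto
    with K show "openin ?Y (?pre (\<Union>K))" by auto
  qed
  then show ?thesis by (simp add: suspension_def)
qed

lemma topspace_suspension: "topspace (suspension X T) = (topspace X \<times> UNIV) // suspension_rel X T"
proof -
  let ?Q = "(topspace X \<times> (UNIV :: real set)) // suspension_rel X T"
  have "{p \<in> topspace X \<times> UNIV. suspension_class X T p \<in> ?Q} = topspace X \<times> UNIV"
    by (auto simp: suspension_class_def quotientI)
  then have "openin (suspension X T) ?Q"
    using openin_topspace[of "prod_topology X euclideanreal"] by (simp add: openin_suspension)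
  then show ?thesis
    by (metis openin_subset openin_suspension openin_topspace subset_antisym)
qed

lemma quotient_map_suspension:
  "quotient_map (prod_topology X euclideanreal) (suspension X T) (suspension_class X T)"
  by (auto simp: quotient_map_def topspace_suspension openin_suspension suspension_class_def quotient_def)

text \<open>A point of the suspension is an equivalence class, and translating the \<open>\<real>\<close>-coordinate of all
  its members takes the class of \<open>(x, t)\<close> to that of \<open>(x, t + s)\<close>.\<close>

definition flow :: "real \<Rightarrow> ('a \<times> real) set \<Rightarrow> ('a \<times> real) set" where
  "flow s z = (\<lambda>(x, t). (x, t + s)) ` z"

definition leaf :: "('a \<times> real) set \<Rightarrow> ('a \<times> real) set set" where
  "leaf z = range (\<lambda>s. flow s z)"

section \<open>The mapping class group\<close>

text \<open>Preservation of orientation is expressed in the time parameters: along each leaf the map is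
  an increasing reparametrization of the flow.\<close>

definition Homeo_plus ::
    "'a topology \<Rightarrow> ('a \<Rightarrow> 'a) \<Rightarrow> (('a \<times> real) set \<Rightarrow> ('a \<times> real) set) monoid" where
  "Homeo_plus X T = (BijGroup (topspace (suspension X T)))
     \<lparr>carrier := {f \<in> Bij (topspace (suspension X T)).
        homeomorphic_map (suspension X T) (suspension X T) f \<and>
        (\<forall>z\<in>topspace (suspension X T).
           f ` leaf z = leaf (f z) \<and>
           (\<exists>h::real \<Rightarrow> real. continuous_on UNIV h \<and> strict_mono h \<and>
              (\<forall>s. f (flow s z) = flow (h s) (f z))))}\<rparr>"

text \<open>The suspension of a Cantor system is compact and metrizable, so all metrics inducing its
  topology yield the same uniform topology (that of the supremum metric) on its self-maps.\<close>

definition suspension_metric :: "'a topology \<Rightarrow> ('a \<Rightarrow> 'a) \<Rightarrow> ('a \<times> real) set metric" where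
  "suspension_metric X T = (SOME m. mtopology_of m = suspension X T)"

definition Homeo_plus_topology ::
    "'a topology \<Rightarrow> ('a \<Rightarrow> 'a) \<Rightarrow> (('a \<times> real) set \<Rightarrow> ('a \<times> real) set) topology" where
  "Homeo_plus_topology X T =
     subtopology (mtopology_of (cfunspace (suspension X T) (suspension_metric X T)))
       (carrier (Homeo_plus X T))"

definition isotopy_class ::
    "'a topology \<Rightarrow> ('a \<Rightarrow> 'a) \<Rightarrow> (('a \<times> real) set \<Rightarrow> ('a \<times> real) set)
      \<Rightarrow> (('a \<times> real) set \<Rightarrow> ('a \<times> real) set) set" where
  "isotopy_class X T f = {g. path_component_of (Homeo_plus_topology X T) f g}"

text \<open>The product is defined on classes by taking the union over all representatives; this is
  the usual \<open>[f][g] = [f \<circ> g]\<close> as the latter is independent of the representatives.\<close>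

definition mapping_class_group ::
    "'a topology \<Rightarrow> ('a \<Rightarrow> 'a) \<Rightarrow> (('a \<times> real) set \<Rightarrow> ('a \<times> real) set) set monoid" where
  "mapping_class_group X T =
     \<lparr>carrier = isotopy_class X T ` carrier (Homeo_plus X T),
      mult = \<lambda>A B. \<Union>f\<in>A. \<Union>g\<in>B. isotopy_class X T (f \<otimes>\<^bsub>Homeo_plus X T\<^esub> g),
      one = isotopy_class X T \<one>\<^bsub>Homeo_plus X T\<^esub>\<rparr>"

section \<open>The homomorphism \<open>\<Psi>\<^sub>C\<close>\<close>

text \<open>Every point of the suspension has the form \<open>[(x, t)]\<close> with \<open>x \<in> C\<close> and
  \<open>0 \<le> t \<le> r\<^sub>C(x)\<close>, uniquely up to the identification of \<open>[(x, r\<^sub>C(x))]\<close> with \<open>[(T\<^sub>C x, 0)]\<close>.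
  The image is the same for both representations because \<open>\<phi>\<close> commutes with \<open>T\<^sub>C\<close>.\<close>

definition suspend ::
    "'a topology \<Rightarrow> ('a \<Rightarrow> 'a) \<Rightarrow> 'a set \<Rightarrow> ('a \<Rightarrow> 'a) \<Rightarrow> ('a \<times> real) set \<Rightarrow> ('a \<times> real) set" where
  "suspend X T C \<phi> = (\<lambda>z\<in>topspace (suspension X T). THE w.
     \<exists>x t. x \<in> C \<and> 0 \<le> t \<and> t \<le> real (return_time T C x) \<and>
       z = suspension_class X T (x, t) \<and>
       w = suspension_class X T
             (\<phi> x, t * real (return_time T C (\<phi> x)) / real (return_time T C x)))"

definition Psi ::
    "'a topology \<Rightarrow> ('a \<Rightarrow> 'a) \<Rightarrow> 'a set \<Rightarrow> ('a \<Rightarrow> 'a) \<Rightarrow> (('a \<times> real) set \<Rightarrow> ('a \<times> real) set) set" where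
  "Psi X T C \<phi> = isotopy_class X T (suspend X T C \<phi>)"

end

theory Submission
  imports Defs
begin

text \<open>Let \<open>Y\<close> be the suspension of \<open>T\<close>, \<open>r\<close> and \<open>R = T\<^sub>C\<close> the return time and the return map of
  the cross section \<open>C\<close>, and \<open>S\<^sub>\<phi>\<close> the homeomorphism of \<open>Y\<close> induced by \<open>\<phi> \<in> Aut(R)\<close>.

  \<^emph>\<open>The kernel contains only powers of\<close> \<open>R\<close>. An isotopy from the identity to \<open>S\<^sub>\<phi>\<close> moves each
  point of \<open>Y\<close> along a path. Transversally to the flow, \<open>Y\<close> looks like the totally disconnected
  space \<open>X\<close>, so a path cannot leave its leaf (\<open>path_component_in_leaf\<close>). Hence \<open>\<phi> x\<close> lies on the
  \<open>T\<close>-orbit of \<open>x\<close> for each \<open>x \<in> C\<close>, and being a point of \<open>C\<close> it is \<open>R\<^sup>k x\<close> for some \<open>k\<close>. Since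
  \<open>\<phi>\<close> commutes with \<open>R\<close>, the exponent of one point serves for its whole \<open>R\<close>-orbit; for a point
  with dense orbit it serves for all of \<open>C\<close> (\<open>commuting_eq_iterate\<close>).

  \<^emph>\<open>The kernel contains\<close> \<open>R\<close>. Passing through the segment over each \<open>x \<in> C\<close> in one unit of time
  gives a coordinate \<open>\<Theta> : C \<times> \<real> \<rightarrow> Y\<close> whose fibres are the points of the suspension of \<open>R\<close>:
  \<open>\<Theta> (R x, u) = \<Theta> (x, u + 1)\<close>. In this coordinate \<open>S\<^sub>\<phi>\<close> is \<open>(x, u) \<mapsto> (\<phi> x, u)\<close>. The maps
  \<open>(x, u) \<mapsto> (x, u + s)\<close> with \<open>0 \<le> s \<le> 1\<close> join the identity to \<open>(x, u) \<mapsto> (x, u + 1)\<close>, which is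
  the same map as \<open>(x, u) \<mapsto> (R x, u)\<close> (\<open>R_isotopic_identity\<close>). The larger family
  \<open>(x, u) \<mapsto> (\<phi> x, u + s)\<close> is treated at once as \<open>shift_lift \<phi> s\<close>: its continuity is checked on
  the compact space \<open>C \<times> [0, 1]\<close>, of which \<open>Y\<close> is a quotient, and along a leaf it is a composition
  of increasing bijections of the time axis.

  \<^emph>\<open>The groups.\<close> The suspension is compact, and it is metrizable because it embeds in a countable
  product of lines (\<open>metrizable_Y\<close>). So the uniform topology is given by a supremum metric, for
  which composition is continuous in each factor. Isotopy is therefore compatible with products,
  and the isotopy classes form a group onto which \<open>f \<mapsto> [f]\<close> is a homomorphism
  (\<open>isotopy_class_hom\<close>).

  The embedding is then the first isomorphism theorem for \<open>C = X\<close>, where \<open>r = 1\<close> and \<open>R = T\<close>.\<close>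

section \<open>Integer iterates\<close>

lemma zpow_0 [simp]: "zpow X T 0 x = x"
  by (simp add: zpow_def)

lemma zpow_of_nat: "zpow X T (int n) = T ^^ n"
  by (simp add: zpow_def)

lemma zpow_one [simp]: "zpow X T 1 x = T x"
  using zpow_of_nat[of X T 1] by simp

lemma zpow_in_topspace:
  assumes "bij_betw T (topspace X) (topspace X)" "x \<in> topspace X"
  shows "zpow X T n x \<in> topspace X"
proof -
  have fun_pow: "(f ^^ k) x \<in> topspace X" if "\<And>y. y \<in> topspace X \<Longrightarrow> f y \<in> topspace X" for f k
    using that assms(2) by (induction k) auto
  show ?thesis
    unfolding zpow_def using fun_pow[of T] fun_pow[of "inv_into (topspace X) T"] assms(1)
    by (auto simp: bij_betw_def inv_into_into)
qed

lemma zpow_succ: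
  assumes "bij_betw T (topspace X) (topspace X)" "x \<in> topspace X"
  shows "zpow X T (n + 1) x = T (zpow X T n x)"
proof (cases "n \<ge> 0")
  case True
  then have "nat (n + 1) = Suc (nat n)" by simp
  with True show ?thesis by (simp add: zpow_def)
next
  case False
  then obtain k where k: "n = - int (Suc k)"
    by (metis int_cases linorder_not_le of_nat_less_0_iff)
  have kin: "(inv_into (topspace X) T ^^ k) x \<in> topspace X"
    using zpow_in_topspace[OF assms, of "- int k"] by (cases "k = 0") (auto simp: zpow_def)
  have "zpow X T (n + 1) x = (inv_into (topspace X) T ^^ k) x"
    by (cases "k = 0") (auto simp: k zpow_def)
  moreover have "nat (- n) = Suc k" "\<not> 0 \<le> n" by (auto simp: k)
  then have "zpow X T n x = inv_into (topspace X) T ((inv_into (topspace X) T ^^ k) x)"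
    by (simp add: zpow_def)
  ultimately show ?thesis
    using kin assms(1) by (simp add: f_inv_into_f bij_betw_def)
qed

text \<open>A bi-infinite orbit is determined by its value at time \<open>0\<close>. The identities between integer
  iterates below rest on this uniqueness.\<close>

lemma zpow_eqI:
  fixes g :: "int \<Rightarrow> 'a"
  assumes bij: "bij_betw T (topspace X) (topspace X)"
    and g: "\<And>n. g n \<in> topspace X" "\<And>n. g (n + 1) = T (g n)"
  shows "g n = zpow X T n (g 0)"
proof (induction n rule: int_induct[where k = 0])
  case base
  show ?case by simp
next
  case (step1 i)
  then show ?case using g zpow_succ[OF bij] by simp
next
  case (step2 i)
  have "T (g (i - 1)) = T (zpow X T (i - 1) (g 0))"
    using g(2)[of "i - 1"] zpow_succ[OF bij g(1), of "i - 1"] step2 by simp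
  then show ?case
    using bij g(1) zpow_in_topspace[OF bij g(1)] by (meson bij_betw_def inj_on_def)
qed

lemma zpow_add:
  assumes bij: "bij_betw T (topspace X) (topspace X)" and x: "x \<in> topspace X"
  shows "zpow X T (m + n) x = zpow X T m (zpow X T n x)"
proof -
  have "zpow X T (k + 1 + n) x = T (zpow X T (k + n) x)" for k
    using zpow_succ[OF bij x, of "k + n"] by (metis add.assoc add.commute)
  then show ?thesis
    using zpow_eqI[OF bij, of "\<lambda>m. zpow X T (m + n) x" m] zpow_in_topspace[OF bij x] by simp
qed

lemma zpow_commute:
  assumes bij: "bij_betw T (topspace X) (topspace X)" "bij_betw S (topspace Y) (topspace Y)"
    and f: "\<And>x. x \<in> topspace X \<Longrightarrow> f x \<in> topspace Y" "\<And>x. x \<in> topspace X \<Longrightarrow> f (T x) = S (f x)"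
    and x: "x \<in> topspace X"
  shows "f (zpow X T n x) = zpow Y S n (f x)"
  using zpow_eqI[OF bij(2), of "\<lambda>n. f (zpow X T n x)"] zpow_in_topspace[OF bij(1) x]
    zpow_succ[OF bij(1) x] f by simp

lemma zpow_uminus:
  assumes "bij_betw T (topspace X) (topspace X)" "x \<in> topspace X"
  shows "zpow X T (- n) (zpow X T n x) = x"
  using zpow_add[OF assms, of "- n" n] by simp

lemma continuous_map_zpow:
  assumes T: "homeomorphic_map X X T"
  shows "continuous_map X X (zpow X T n)"
proof -
  obtain g where g: "homeomorphic_maps X X T g"
    using T homeomorphic_map_maps by blast
  have "inv_into (topspace X) T x = g x" if "x \<in> topspace X" for x
  proof (rule inv_into_f_eq)
    show "inj_on T (topspace X)" using T by (simp add: homeomorphic_eq_everything_map)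
  qed (use g that in \<open>auto simp: homeomorphic_maps_def continuous_map_def\<close>)
  then have inv: "continuous_map X X (inv_into (topspace X) T)"
    using g continuous_map_eq[of X X g] by (auto simp: homeomorphic_maps_def)
  have *: "continuous_map X X (f ^^ k)" if "continuous_map X X f" for f k
    using that by (induction k) (auto simp: id_def intro: continuous_map_compose)
  show ?thesis
    unfolding zpow_def using *[OF inv] *[OF homeomorphic_imp_continuous_map[OF T]] by simp
qed

section \<open>Points and leaves of the suspension\<close>

locale aperiodic_system =
  fixes X :: "'a topology" and T :: "'a \<Rightarrow> 'a"
  assumes Cantor: "Cantor_system X T" and aper: "aperiodic X T"
begin

abbreviation Y where "Y \<equiv> suspension X T"
abbreviation cls where "cls \<equiv> suspension_class X T"

lemma homeo: "homeomorphic_map X X T"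
  using Cantor by (simp add: Cantor_system_def)

lemma bij: "bij_betw T (topspace X) (topspace X)"
  using homeo by (simp add: homeomorphic_eq_everything_map bij_betw_def)

lemma zpow_in [simp, intro]: "x \<in> topspace X \<Longrightarrow> zpow X T n x \<in> topspace X"
  using zpow_in_topspace[OF bij] .

lemma T_in [simp, intro]: "x \<in> topspace X \<Longrightarrow> T x \<in> topspace X"
  using zpow_in[of x 1] by simp

lemma zpow_inj:
  assumes x: "x \<in> topspace X" and eq: "zpow X T m x = zpow X T n x"
  shows "m = n"
proof -
  have aux: False if "m < n" "zpow X T m x = zpow X T n x" for m n
  proof -
    have "zpow X T (n - m) (zpow X T m x) = zpow X T m x"
      using zpow_add[OF bij x, of "n - m" m] that by simp
    moreover have "zpow X T (n - m) = T ^^ nat (n - m)" "nat (n - m) \<ge> 1"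
      using that by (auto simp: zpow_def)
    ultimately show False
      using aper zpow_in[OF x] by (auto simp: aperiodic_def)
  qed
  show ?thesis using aux[of m n] aux[of n m] eq by (metis linorder_neqE)
qed

text \<open>The equivalence relation is the orbit relation of the action \<open>n \<cdot> (x, t) = (T\<^sup>n x, t - n)\<close> of
  the integers, so its three properties come from the unit, inverses and products of \<open>\<int>\<close>.\<close>

lemma equiv_suspension_rel: "equiv (topspace X \<times> UNIV) (suspension_rel X T)"
proof (rule equivI)
  show "suspension_rel X T \<subseteq> (topspace X \<times> UNIV) \<times> (topspace X \<times> UNIV)"
    by (auto simp: suspension_rel_def)
  show "refl_on (topspace X \<times> UNIV) (suspension_rel X T)"
  proof (rule refl_onI, clarify)
    fix x and t :: real assume x: "x \<in> topspace X"
    have "((x, t), (zpow X T 0 x, t - of_int 0)) \<in> suspension_rel X T"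
      using x unfolding suspension_rel_def by blast
    then show "((x, t), (x, t)) \<in> suspension_rel X T" by simp
  qed
  show "sym (suspension_rel X T)"
  proof (rule symI)
    fix p q assume "(p, q) \<in> suspension_rel X T"
    then obtain x t n where x: "x \<in> topspace X" "p = (x, t)" "q = (zpow X T n x, t - of_int n)"
      by (auto simp: suspension_rel_def)
    have "p = (zpow X T (- n) (zpow X T n x), t - of_int n - of_int (- n))"
      using zpow_uminus[OF bij x(1)] x by simp
    then show "(q, p) \<in> suspension_rel X T"
      using x unfolding suspension_rel_def by blast
  qed
  show "trans (suspension_rel X T)"
  proof (rule transI)
    fix p q r assume "(p, q) \<in> suspension_rel X T" "(q, r) \<in> suspension_rel X T"
    then obtain x t n m where x: "x \<in> topspace X" "p = (x, t)"
      "r = (zpow X T m (zpow X T n x), t - of_int n - of_int m)"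
      by (auto simp: suspension_rel_def)
    then have "r = (zpow X T (m + n) x, t - of_int (m + n))"
      using zpow_add[OF bij x(1)] by simp
    then show "(p, r) \<in> suspension_rel X T"
      using x unfolding suspension_rel_def by blast
  qed
qed

lemma cls_eq_iff:
  assumes "x \<in> topspace X" "y \<in> topspace X"
  shows "cls (x, t) = cls (y, s) \<longleftrightarrow> (\<exists>n. y = zpow X T n x \<and> s = t - of_int n)"
proof -
  have "cls (x, t) = cls (y, s) \<longleftrightarrow> ((x, t), (y, s)) \<in> suspension_rel X T"
    unfolding suspension_class_def using equiv_suspension_rel assms
    by (simp add: eq_equiv_class_iff)
  then show ?thesis using assms by (auto simp: suspension_rel_def)
qed

lemma cls_zpow: "x \<in> topspace X \<Longrightarrow> cls (zpow X T n x, t) = cls (x, t + of_int n)"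
  by (subst eq_commute) (auto simp: cls_eq_iff intro!: exI[of _ n])

text \<open>Here aperiodicity enters: a leaf is an injective image of the time axis.\<close>

lemma cls_inj: "x \<in> topspace X \<Longrightarrow> cls (x, t) = cls (x, s) \<longleftrightarrow> t = s"
  using zpow_inj[of x 0] by (auto simp: cls_eq_iff intro: exI[of _ 0])

lemma topspace_Y: "topspace Y = cls ` (topspace X \<times> UNIV)"
  by (auto simp: topspace_suspension quotient_def suspension_class_def)

lemma cls_in [simp, intro]: "x \<in> topspace X \<Longrightarrow> cls (x, t) \<in> topspace Y"
  by (auto simp: topspace_Y)

lemma cls_cases:
  assumes "z \<in> topspace Y"
  obtains x t where "x \<in> topspace X" "z = cls (x, t)"
  using assms by (auto simp: topspace_Y)

lemma flow_cls:
  assumes x: "x \<in> topspace X"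
  shows "flow s (cls (x, t)) = cls (x, t + s)"
proof -
  have *: "cls (x, t) = {(zpow X T n x, t - of_int n) |n. True}" for t
    using x by (auto simp: suspension_class_def suspension_rel_def)
  have "t + s - of_int n = t - of_int n + s" for n by simp
  then show ?thesis
    unfolding * flow_def by (auto simp: image_iff) 
qed

lemma leaf_cls: "x \<in> topspace X \<Longrightarrow> leaf (cls (x, t)) = range (\<lambda>s. cls (x, s))"
proof -
  assume x: "x \<in> topspace X"
  have "cls (x, s) = flow (s - t) (cls (x, t))" for s using x by (simp add: flow_cls)
  then have "range (\<lambda>s. cls (x, s)) \<subseteq> leaf (cls (x, t))" unfolding leaf_def by blast
  moreover have "leaf (cls (x, t)) \<subseteq> range (\<lambda>s. cls (x, s))"
    unfolding leaf_def using x by (auto simp: flow_cls)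
  ultimately show ?thesis by blast
qed

lemma continuous_map_cls: "continuous_map (prod_topology X euclideanreal) Y cls"
  using quotient_map_suspension quotient_imp_continuous_map by blast

lemma compact_X: "compact_space X"
proof -
  have "compact_space (product_topology (\<lambda>_::nat. discrete_topology (UNIV :: bool set)) UNIV)"
    by (simp add: compact_space_product_topology compact_space_discrete_topology)
  then show ?thesis
    using Cantor homeomorphic_compact_space by (auto simp: Cantor_system_def Cantor_set_def)
qed

lemma topspace_Y_unit: "topspace Y = cls ` (topspace X \<times> {0..1})"
proof -
  have "\<exists>y s. y \<in> topspace X \<and> s \<in> {0..1} \<and> cls (x, t) = cls (y, s)" if "x \<in> topspace X" for x t
    using cls_zpow[OF that, of "\<lfloor>t\<rfloor>" "frac t"] that frac_lt_1[of t]
    by (intro exI[of _ "zpow X T \<lfloor>t\<rfloor> x"] exI[of _ "frac t"])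
      (auto simp: frac_def) 
  then have "topspace Y \<subseteq> cls ` (topspace X \<times> {0..1})"
    unfolding topspace_Y by (auto simp: image_iff Bex_def)
  then show ?thesis by (auto simp: topspace_Y)
qed

lemma compact_Y: "compact_space Y"
proof -
  have "compactin (prod_topology X euclideanreal) (topspace X \<times> {0..1})"
    using compact_X by (simp add: compactin_Times compact_space_def)
  then show ?thesis
    unfolding compact_space_def topspace_Y_unit by (rule image_compactin[OF _ continuous_map_cls])
qed

end

section \<open>The suspension is metrizable\<close>

lemma continuous_map_by_unit_intervals:
  fixes f :: "int \<Rightarrow> 'a \<times> real \<Rightarrow> 'b"
  assumes cont: "\<And>k. continuous_map
        (subtopology (prod_topology A euclideanreal) (topspace A \<times> {of_int k..of_int k + 1})) B (f k)"
    and match: "\<And>k x. x \<in> topspace A \<Longrightarrow> f k (x, of_int k + 1) = f (k + 1) (x, of_int k + 1)"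
    and g: "\<And>x u. x \<in> topspace A \<Longrightarrow> g (x, u) = f \<lfloor>u\<rfloor> (x, u)"
  shows "continuous_map (prod_topology A euclideanreal) B g"
proof (rule pasting_lemma_locally_finite[where I = UNIV and f = f
      and T = "\<lambda>k. topspace A \<times> {of_int k..of_int k + 1}"])
  fix p assume "p \<in> topspace (prod_topology A euclideanreal)"
  then obtain x u where p: "p = (x, u)" "x \<in> topspace A" by auto
  let ?V = "topspace A \<times> {u - 1<..<u + 1}"
  have "i \<in> {\<lfloor>u\<rfloor> - 3..\<lfloor>u\<rfloor> + 3}"
    if "real_of_int i \<le> v" "v \<le> real_of_int i + 1" "u - 1 < v" "v < u + 1" for i v
    using that unfolding atLeastAtMost_iff by linarith
  then have "{i \<in> UNIV. topspace A \<times> {real_of_int i..real_of_int i + 1} \<inter> ?V \<noteq> {}}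
      \<subseteq> {\<lfloor>u\<rfloor> - 3..\<lfloor>u\<rfloor> + 3}" by fastforce
  then have "finite {i \<in> UNIV. topspace A \<times> {real_of_int i..real_of_int i + 1} \<inter> ?V \<noteq> {}}"
    by (rule finite_subset) simp
  moreover have "openin (prod_topology A euclideanreal) ?V"
    by (simp add: openin_prod_Times_iff)
  ultimately show "\<exists>V. openin (prod_topology A euclideanreal) V \<and> p \<in> V \<and>
      finite {i \<in> UNIV. topspace A \<times> {real_of_int i..real_of_int i + 1} \<inter> V \<noteq> {}}"
    using p by (intro exI[of _ ?V]) auto
next
  fix i
  show "closedin (prod_topology A euclideanreal) (topspace A \<times> {real_of_int i..real_of_int i + 1})"
    by (simp add: closedin_prod_Times_iff)
next
  fix i j p
  assume "p \<in> topspace (prod_topology A euclideanreal)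
      \<inter> topspace A \<times> {real_of_int i..real_of_int i + 1} \<inter> topspace A \<times> {real_of_int j..real_of_int j + 1}"
  then obtain x u where p: "p = (x, u)" "x \<in> topspace A" "real_of_int i \<le> u" "u \<le> real_of_int i + 1"
     "real_of_int j \<le> u" "u \<le> real_of_int j + 1" by auto
  then consider "i = j" | "j = i + 1" "u = real_of_int i + 1" | "i = j + 1" "u = real_of_int j + 1"
    by linarith
  then show "f i p = f j p"
    using match p by cases auto
next
  fix p assume "p \<in> topspace (prod_topology A euclideanreal)"
  then obtain x u where "p = (x, u)" "x \<in> topspace A" by auto
  then show "\<exists>j. j \<in> UNIV \<and> p \<in> topspace A \<times> {real_of_int j..real_of_int j + 1} \<and> g p = f j p"
    using g by (intro exI[of _ "\<lfloor>u\<rfloor>"]) (auto simp: less_imp_le)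
qed (use cont in auto)

context aperiodic_system
begin

lemma zpow_cancel: "zpow X T n x = zpow X T n y \<longleftrightarrow> x = y" if "x \<in> topspace X" "y \<in> topspace X"
  using zpow_uminus[OF bij that(1), of n] zpow_uminus[OF bij that(2), of n] by metis

text \<open>The suspension is embedded in a countable product of lines. Let \<open>b x i\<close> be the coordinates of a
  point of the Cantor set. The functions \<open>b (T\<^sup>n x) i * (t - n) * (n + 1 - t)\<close> for \<open>n \<le> t \<le> n + 1\<close>
  fit together at the integers, where they vanish; they are constant on equivalence classes, and they
  determine \<open>x\<close> if \<open>t\<close> is known and not an integer. Their translates by \<open>1/2\<close> do the same for integer
  \<open>t\<close>, and the angle \<open>2 \<pi> t\<close> determines \<open>t\<close> up to an integer.\<close>

lemma metrizable_Y: "metrizable_space Y"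
proof -
  let ?XR = "prod_topology X euclideanreal"
  obtain b where b: "homeomorphic_map X (product_topology (\<lambda>_::nat. discrete_topology (UNIV :: bool set)) UNIV) b"
    using Cantor by (auto simp: Cantor_system_def Cantor_set_def homeomorphic_space)
  define w :: "'a \<times> real \<Rightarrow> nat \<Rightarrow> real" where
    "w = (\<lambda>(x, t) i. of_bool (b (zpow X T \<lfloor>t\<rfloor> x) i) * (frac t * (1 - frac t)))"
  have b_coord: "continuous_map X euclideanreal (\<lambda>x. of_bool (b x i))" for i
  proof -
    have "continuous_map X (discrete_topology UNIV) (\<lambda>x. b x i)"
      using homeomorphic_imp_continuous_map[OF b] by (simp add: continuous_map_componentwise_UNIV)
    then have "continuous_map X euclideanreal (of_bool \<circ> (\<lambda>x. b x i))"
      by (rule continuous_map_compose) simp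
    then show ?thesis by (simp add: o_def)
  qed
  have w_cont: "continuous_map ?XR (product_topology (\<lambda>_. euclideanreal) UNIV) w"
  proof (rule continuous_map_by_unit_intervals)
    fix k :: int
    have "continuous_map ?XR euclideanreal
        (\<lambda>p. of_bool (b (zpow X T k (fst p)) i) * ((snd p - of_int k) * (of_int k + 1 - snd p)))" for i
    proof (intro continuous_map_real_mult continuous_map_diff continuous_map_snd continuous_map_canonical_const)
      have "continuous_map ?XR euclideanreal
        ((\<lambda>x. of_bool (b x i)) \<circ> (zpow X T k \<circ> fst))"
        by (intro continuous_map_compose[OF _ b_coord] continuous_map_compose[OF continuous_map_fst]
            continuous_map_zpow homeo)
      then show "continuous_map ?XR euclideanreal (\<lambda>p. of_bool (b (zpow X T k (fst p)) i))"
        by (simp add: o_def)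
    qed
    then show "continuous_map (subtopology ?XR (topspace X \<times> {of_int k..of_int k + 1}))
        (product_topology (\<lambda>_. euclideanreal) UNIV)
        (\<lambda>p i. of_bool (b (zpow X T k (fst p)) i) * ((snd p - of_int k) * (of_int k + 1 - snd p)))"
      by (intro continuous_map_from_subtopology) (simp add: continuous_map_componentwise_UNIV)
  qed (auto simp: w_def frac_def)
  have w_invariant: "w (zpow X T n x, t - of_int n) = w (x, t)" if "x \<in> topspace X" for x t n
    using zpow_add[OF bij that, of "\<lfloor>t\<rfloor> - n" n] by (simp add: w_def frac_def)
  have w_inj: "x = y"
    if "w (x, t) = w (y, t)" "frac t \<noteq> 0" "x \<in> topspace X" "y \<in> topspace X" for x y t
  proof -
    have "b (zpow X T \<lfloor>t\<rfloor> x) i = b (zpow X T \<lfloor>t\<rfloor> y) i" for i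
      using fun_cong[OF that(1), of i] that(2) frac_lt_1[of t] by (simp add: w_def of_bool_def split: if_splits)
    then have "b (zpow X T \<lfloor>t\<rfloor> x) = b (zpow X T \<lfloor>t\<rfloor> y)" by blast
    then have "zpow X T \<lfloor>t\<rfloor> x = zpow X T \<lfloor>t\<rfloor> y"
      using b that zpow_in by (metis homeomorphic_eq_everything_map inj_onD)
    then show ?thesis using that zpow_cancel by simp
  qed
  define e where "e = (\<lambda>(x, t). ((w (x, t), w (x, t + 1/2)), (cos (2 * pi * t), sin (2 * pi * t))))"
  let ?R = "product_topology (\<lambda>_::nat. euclideanreal) UNIV"
  let ?Z = "prod_topology (prod_topology ?R ?R) (prod_topology euclideanreal euclideanreal)"
  have e_cont: "continuous_map ?XR ?Z e"
  proof -
    have "continuous_map ?XR ?XR (\<lambda>p. (fst p, snd p + 1/2))"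
      by (intro continuous_map_pairedI continuous_map_fst continuous_map_add continuous_map_snd) auto
    then have "continuous_map ?XR ?R (w \<circ> (\<lambda>p. (fst p, snd p + 1/2)))"
      using w_cont continuous_map_compose by blast
    moreover have "continuous_map ?XR euclideanreal ((\<lambda>t. cos (2 * pi * t)) \<circ> snd)"
      "continuous_map ?XR euclideanreal ((\<lambda>t. sin (2 * pi * t)) \<circ> snd)"
      by (rule continuous_map_compose[OF continuous_map_snd], simp,
          intro continuous_intros)+
    ultimately have "continuous_map ?XR ?Z (\<lambda>p. ((w p, (w \<circ> (\<lambda>p. (fst p, snd p + 1/2))) p),
        (((\<lambda>t. cos (2 * pi * t)) \<circ> snd) p, ((\<lambda>t. sin (2 * pi * t)) \<circ> snd) p)))"
      using w_cont by (intro continuous_map_pairedI)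
    then show ?thesis by (simp add: e_def o_def case_prod_unfold)
  qed
  \<comment> \<open>The fibres of \<open>e\<close> are the points of the suspension, so \<open>e\<close> descends to an injective map.\<close>
  have e_iff: "e (x, t) = e (y, s) \<longleftrightarrow> cls (x, t) = cls (y, s)"
    if xy: "x \<in> topspace X" "y \<in> topspace X" for x y t s
  proof
    assume "cls (x, t) = cls (y, s)"
    then obtain n where n: "y = zpow X T n x" "s = t - of_int n" using cls_eq_iff[OF xy] by blast
    have "2 * pi * t = 2 * pi * s + 2 * of_int n * pi" unfolding n by (simp add: n algebra_simps distrib_left)
    then have "sin (2 * pi * t) = sin (2 * pi * s) \<and> cos (2 * pi * t) = cos (2 * pi * s)"
      unfolding sin_cos_eq_iff by (intro exI[of _ n]) (simp add: algebra_simps)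
    moreover have "w (y, s) = w (x, t)" "w (y, s + 1/2) = w (x, t + 1/2)"
      using w_invariant[OF xy(1), of n t] w_invariant[OF xy(1), of n "t + 1/2"]
      unfolding n by (simp_all add: algebra_simps)
    ultimately show "e (x, t) = e (y, s)" by (simp add: e_def)
  next
    assume e: "e (x, t) = e (y, s)"
    then have "sin (2 * pi * s) = sin (2 * pi * t) \<and> cos (2 * pi * s) = cos (2 * pi * t)"
      by (simp add: e_def)
    then obtain n :: int where "2 * pi * s = 2 * pi * t + 2 * pi * of_int n"
      unfolding sin_cos_eq_iff by blast
    then have "2 * pi * s = 2 * pi * (t + of_int n)" by (simp add: distrib_left)
    then have s: "s = t + of_int n" by simp
    have y': "zpow X T n y \<in> topspace X" using xy by simp
    \<comment> \<open>Move \<open>(y, s)\<close> to the same height \<open>t\<close>; there \<open>t\<close> or \<open>t + 1/2\<close> is not an integer.\<close>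
    have "w (x, t) = w (zpow X T n y, t)" "w (x, t + 1/2) = w (zpow X T n y, t + 1/2)"
      using e w_invariant[OF xy(2), of n s] w_invariant[OF xy(2), of n "s + 1/2"]
      by (auto simp: e_def s algebra_simps)
    moreover have "frac t \<noteq> 0 \<or> frac (t + 1/2) \<noteq> 0"
    proof (rule ccontr)
      assume "\<not> ?thesis"
      then obtain i j :: int where "t = of_int i" "t + 1/2 = of_int j" by (auto elim!: Ints_cases)
      then have "2 * real_of_int j = 2 * of_int i + 1" by simp
      then have "2 * j = 2 * i + 1" by linarith
      then show False by presburger
    qed
    ultimately have "x = zpow X T n y" using w_inj xy y' by blast
    then show "cls (x, t) = cls (y, s)" using cls_zpow[OF xy(2)] s by simp
  qed
  have e_fibre: "e p = e q" if "p \<in> topspace ?XR" "q \<in> topspace ?XR" "cls p = cls q" for p q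
    using e_iff[of "fst p" "fst q" "snd p" "snd q"] that by auto
  obtain h where h: "continuous_map Y ?Z h" "\<And>p. p \<in> topspace ?XR \<Longrightarrow> h (cls p) = e p"
    by (rule quotient_map_lift_exists[OF quotient_map_suspension[of X T] e_cont]) (use e_fibre in blast)+
  have met: "metrizable_space ?Z"
    by (simp add: metrizable_space_prod_topology euclidean_product_topology metrizable_space_euclidean)
  have "inj_on h (topspace Y)"
    using h(2) e_iff by (auto simp: inj_on_def topspace_Y)
  then have "embedding_map Y ?Z h"
    using continuous_imp_embedding_map h(1) compact_Y met metrizable_imp_Hausdorff_space by blast
  then show ?thesis
    using met by (meson embedding_map_imp_homeomorphic_space homeomorphic_metrizable_space
        metrizable_space_subtopology)
qed

lemma Hausdorff_Y: "Hausdorff_space Y"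
  using metrizable_Y metrizable_imp_Hausdorff_space by blast

end

section \<open>Groups of homeomorphisms\<close>

lemma Bij_subgroup_is_group:
  assumes sub: "K \<subseteq> Bij S" and one: "(\<lambda>x\<in>S. x) \<in> K"
    and mult: "\<And>f g. f \<in> K \<Longrightarrow> g \<in> K \<Longrightarrow> compose S f g \<in> K"
    and inv: "\<And>f. f \<in> K \<Longrightarrow> (\<lambda>x\<in>S. inv_into S f x) \<in> K"
  shows "group ((BijGroup S) \<lparr>carrier := K\<rparr>)"
proof (rule subgroup.subgroup_is_group[OF _ group_BijGroup])
  show "subgroup K (BijGroup S)"
  proof (rule group.subgroupI[OF group_BijGroup])
    show "K \<subseteq> carrier (BijGroup S)" using sub by (simp add: BijGroup_def)
    show "K \<noteq> {}" using one by blast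
    show "m_inv (BijGroup S) f \<in> K" if "f \<in> K" for f
      using inv[OF that] sub that by (simp add: inv_BijGroup subset_iff)
    show "f \<otimes>\<^bsub>BijGroup S\<^esub> g \<in> K" if "f \<in> K" "g \<in> K" for f g
    proof -
      have "f \<in> Bij S" "g \<in> Bij S" using sub that by auto
      then show ?thesis using mult[OF that] by (simp add: BijGroup_def)
    qed
  qed
qed

lemma Aut_group_group:
  assumes S: "\<And>x. x \<in> topspace X \<Longrightarrow> S x \<in> topspace X"
  shows "group (Aut_group X S)"
  unfolding Aut_group_def
proof (rule Bij_subgroup_is_group)
  let ?K = "{f \<in> Bij (topspace X). homeomorphic_map X X f \<and> (\<forall>x\<in>topspace X. f (S x) = S (f x))}"
  show "(\<lambda>x\<in>topspace X. x) \<in> ?K"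
  proof -
    have "homeomorphic_map X X (\<lambda>x\<in>topspace X. x)"
      by (rule homeomorphic_map_eq[OF homeomorphic_map_id[THEN iffD2, OF refl]]) simp
    then show ?thesis using S by (simp add: id_Bij)
  qed
  show "compose (topspace X) f g \<in> ?K" if "f \<in> ?K" "g \<in> ?K" for f g
  proof -
    have "homeomorphic_map X X (f \<circ> g)" using that homeomorphic_map_compose by blast
    then have "homeomorphic_map X X (compose (topspace X) f g)"
      by (rule homeomorphic_map_eq) (simp add: compose_def)
    moreover have "g x \<in> topspace X" if "x \<in> topspace X" for x
      using Bij_imp_funcset \<open>g \<in> ?K\<close> that by blast
    ultimately show ?thesis
      using that S by (simp add: compose_Bij) (simp add: compose_def)
  qed
  show "(\<lambda>x\<in>topspace X. inv_into (topspace X) f x) \<in> ?K" if f: "f \<in> ?K" for f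
  proof -
    let ?g = "inv_into (topspace X) f"
    have bij: "bij_betw f (topspace X) (topspace X)" using f by (simp add: Bij_def)
    have g: "?g y \<in> topspace X" "f (?g y) = y" if "y \<in> topspace X" for y
      using bij that by (auto simp: bij_betw_def inv_into_into f_inv_into_f)
    obtain g' where g': "homeomorphic_maps X X f g'" using f homeomorphic_map_maps by blast
    have "g' y = ?g y" if "y \<in> topspace X" for y
      using g[OF that] g' by (metis homeomorphic_maps_def)
    moreover have "homeomorphic_map X X g'" using g' homeomorphic_maps_map by blast
    ultimately have "homeomorphic_map X X (restrict ?g (topspace X))"
      using homeomorphic_map_eq[of X X g'] by simp
    moreover have "?g (S y) = S (?g y)" if "y \<in> topspace X" for y
    proof (rule inv_into_f_eq)
      show "inj_on f (topspace X)" using bij by (simp add: bij_betw_def)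
      show "S (?g y) \<in> topspace X" using S g that by simp
      show "f (S (?g y)) = S y" using f g[OF that] by auto
    qed
    ultimately show ?thesis using f S g by (simp add: restrict_inv_into_Bij)
  qed
qed auto

lemma mult_Aut_group:
  "f \<in> carrier (Aut_group X S) \<Longrightarrow> g \<in> carrier (Aut_group X S)
    \<Longrightarrow> f \<otimes>\<^bsub>Aut_group X S\<^esub> g = compose (topspace X) f g"
  by (simp add: Aut_group_def BijGroup_def)

lemma one_Aut_group: "\<one>\<^bsub>Aut_group X S\<^esub> = (\<lambda>x\<in>topspace X. x)"
  by (simp add: Aut_group_def BijGroup_def)

lemma inv_reparam:
  fixes h :: "real \<Rightarrow> real"
  assumes "strict_mono h" "surj h"
  shows "strict_mono (inv_into UNIV h)" "surj (inv_into UNIV h)"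
proof -
  have inj: "inj h" using assms(1) by (simp add: strict_mono_imp_inj_on)
  show "surj (inv_into UNIV h)" using inj by (rule inj_imp_surj_inv)
  show "strict_mono (inv_into UNIV h)"
  proof (rule strict_monoI)
    fix x y :: real assume "x < y"
    then have "h (inv_into UNIV h x) < h (inv_into UNIV h y)" using assms(2) by (simp add: f_inv_into_f)
    then show "inv_into UNIV h x < inv_into UNIV h y" using assms(1) by (simp add: strict_mono_less)
  qed
qed

lemma continuous_reparam:
  fixes h :: "real \<Rightarrow> real"
  assumes "strict_mono h" "surj h"
  shows "continuous_on UNIV h"
  using assms by (intro continuous_onI_mono) (auto simp: strict_mono_less_eq)

context aperiodic_system
begin

text \<open>The function \<open>h\<close> is \<open>f\<close> in the time coordinates of the leaf of \<open>x\<close> and of its image. In contrast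
  to the condition that defines \<^const>\<open>Homeo_plus\<close>, the times are not counted from a point and its
  image, so that compositions and inverses of \<open>f\<close> correspond to those of \<open>h\<close>; surjectivity of \<open>h\<close>
  expresses that \<open>f\<close> maps leaves onto leaves.\<close>

definition leafwise :: "(('a \<times> real) set \<Rightarrow> ('a \<times> real) set) \<Rightarrow> bool" where
  "leafwise f \<longleftrightarrow> (\<forall>x\<in>topspace X. \<exists>y\<in>topspace X. \<exists>h::real \<Rightarrow> real. strict_mono h \<and> surj h \<and>
     (\<forall>s. f (cls (x, s)) = cls (y, h s)))"

lemma homeomorphic_map_Y:
  assumes "f \<in> Bij (topspace Y)" "continuous_map Y Y f"
  shows "homeomorphic_map Y Y f"
  using assms continuous_imp_homeomorphic_map[OF assms(2) compact_Y Hausdorff_Y]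
  by (auto simp: Bij_def bij_betw_def)

text \<open>Continuity of the inverse is automatic as the suspension is compact and Hausdorff. The two ways
  to describe the behaviour on leaves agree because time is an injective coordinate on a leaf:
  covering the image leaf means covering the time axis.\<close>

lemma carrier_Homeo_plus:
  "carrier (Homeo_plus X T) = {f \<in> Bij (topspace Y). continuous_map Y Y f \<and> leafwise f}"
proof (intro equalityI subsetI)
  fix f assume f: "f \<in> carrier (Homeo_plus X T)"
  then have bijf: "f \<in> Bij (topspace Y)" and hom: "homeomorphic_map Y Y f"
    by (auto simp: Homeo_plus_def)
  have "\<exists>y\<in>topspace X. \<exists>h::real \<Rightarrow> real. strict_mono h \<and> surj h \<and> (\<forall>s. f (cls (x, s)) = cls (y, h s))"
    if x: "x \<in> topspace X" for x
  proof -
    have "\<forall>z\<in>topspace Y. f ` leaf z = leaf (f z) \<and> (\<exists>h::real \<Rightarrow> real. continuous_on UNIV h \<and>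
        strict_mono h \<and> (\<forall>s. f (flow s z) = flow (h s) (f z)))"
      using f by (simp add: Homeo_plus_def)
    from bspec[OF this cls_in[OF x, of 0]]
    obtain h where h: "strict_mono h" "\<And>s. f (flow s (cls (x, 0))) = flow (h s) (f (cls (x, 0)))"
      and leaf: "f ` leaf (cls (x, 0)) = leaf (f (cls (x, 0)))" by blast
    have "f (cls (x, 0)) \<in> topspace Y" using Bij_imp_funcset[OF bijf] x by blast
    then obtain y t where y: "y \<in> topspace X" "f (cls (x, 0)) = cls (y, t)" by (rule cls_cases)
    have eq: "f (cls (x, s)) = cls (y, t + h s)" for s
      using h(2)[of s] x y by (simp add: flow_cls)
    have "surj (\<lambda>s. t + h s)"
    proof (rule surjI)
      fix r
      have "cls (y, r) \<in> f ` leaf (cls (x, 0))" using leaf y by (simp add: leaf_cls)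
      then have "\<exists>s. cls (y, r) = cls (y, t + h s)" using x eq by (auto simp: leaf_cls)
      then have "\<exists>s. t + h s = r" using y(1) cls_inj by metis
      then show "t + h (SOME s. t + h s = r) = r" by (rule someI_ex)
    qed
    moreover have "strict_mono (\<lambda>s. t + h s)" using h(1) by (simp add: strict_mono_def)
    ultimately show ?thesis using y(1) eq by (intro bexI exI conjI allI)
  qed
  then show "f \<in> {f \<in> Bij (topspace Y). continuous_map Y Y f \<and> leafwise f}"
    using bijf hom by (simp add: leafwise_def homeomorphic_imp_continuous_map)
next
  fix f assume "f \<in> {f \<in> Bij (topspace Y). continuous_map Y Y f \<and> leafwise f}"
  then have bijf: "f \<in> Bij (topspace Y)" and cont: "continuous_map Y Y f" and lw: "leafwise f"
    by auto
  have "f ` leaf z = leaf (f z) \<and> (\<exists>h::real \<Rightarrow> real. continuous_on UNIV h \<and> strict_mono h \<and>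
      (\<forall>s. f (flow s z) = flow (h s) (f z)))" if z: "z \<in> topspace Y" for z
  proof -
    obtain x t where x: "x \<in> topspace X" "z = cls (x, t)" using z cls_cases by blast
    obtain y h where y: "y \<in> topspace X" and h: "strict_mono h" "surj h"
      and eq: "\<And>s. f (cls (x, s)) = cls (y, h s)"
      using lw x(1) unfolding leafwise_def by metis
    have "f ` leaf z = range (\<lambda>s. cls (y, h s))" using x by (simp add: leaf_cls eq image_image)
    also have "\<dots> = (\<lambda>r. cls (y, r)) ` range h" by (simp add: image_image)
    also have "\<dots> = leaf (f z)" using x y h by (simp add: eq leaf_cls)
    finally have "f ` leaf z = leaf (f z)" .
    moreover have "continuous_on UNIV (\<lambda>s. h (t + s) - h t)"
      by (intro continuous_intros continuous_on_compose2[OF continuous_reparam[OF h]]) auto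
    moreover have "strict_mono (\<lambda>s. h (t + s) - h t)" using h(1) by (simp add: strict_mono_def)
    moreover have "f (flow s z) = flow (h (t + s) - h t) (f z)" for s
      using x y by (simp add: eq flow_cls)
    ultimately show ?thesis by blast
  qed
  then show "f \<in> carrier (Homeo_plus X T)"
    using bijf homeomorphic_map_Y[OF bijf cont] by (simp add: Homeo_plus_def)
qed

lemma leafwise_compose:
  assumes "leafwise f" "leafwise g"
  shows "leafwise (compose (topspace Y) f g)"
  unfolding leafwise_def
proof
  fix x assume x: "x \<in> topspace X"
  obtain y h where y: "y \<in> topspace X" and h: "strict_mono h" "surj h"
    "\<And>s. g (cls (x, s)) = cls (y, h s)" using assms(2) x unfolding leafwise_def by metis
  obtain z k where z: "z \<in> topspace X" and k: "strict_mono k" "surj k"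
    "\<And>s. f (cls (y, s)) = cls (z, k s)" using assms(1) y unfolding leafwise_def by metis
  have "strict_mono (k \<circ> h)" "surj (k \<circ> h)"
    using h(1) k(1) comp_surj[OF h(2) k(2)] by (auto simp: strict_mono_def)
  moreover have "compose (topspace Y) f g (cls (x, s)) = cls (z, (k \<circ> h) s)" for s
    using x h k by (simp add: compose_def)
  ultimately show "\<exists>y\<in>topspace X. \<exists>h::real \<Rightarrow> real. strict_mono h \<and> surj h \<and>
      (\<forall>s. compose (topspace Y) f g (cls (x, s)) = cls (y, h s))"
    using z by blast
qed

lemma leafwise_inverse:
  assumes f: "f \<in> Bij (topspace Y)" and lw: "leafwise f"
  shows "leafwise (\<lambda>z\<in>topspace Y. inv_into (topspace Y) f z)"
  unfolding leafwise_def
proof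
  fix y assume y: "y \<in> topspace X"
  have bijf: "bij_betw f (topspace Y) (topspace Y)" using f by (simp add: Bij_def)
  then have "cls (y, 0) \<in> f ` topspace Y" using y by (simp add: bij_betw_def)
  then obtain x t where x: "x \<in> topspace X" and xt: "f (cls (x, t)) = cls (y, 0)"
    by (metis imageE cls_cases)
  obtain y' h where y': "y' \<in> topspace X" and h: "strict_mono h" "surj h"
    and eq: "\<And>s. f (cls (x, s)) = cls (y', h s)" using lw x unfolding leafwise_def by metis
  \<comment> \<open>The leaves of \<open>y\<close> and \<open>y'\<close> coincide, but their time coordinates differ by an integer \<open>n\<close>.\<close>
  have "cls (y', h t) = cls (y, 0)" using eq xt by simp
  then obtain n where "y = zpow X T n y'" using cls_eq_iff[OF y' y] by blast
  then have "cls (y, s) = cls (y', s + of_int n)" for s using y' by (simp add: cls_zpow)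
  then have "f (cls (x, inv_into UNIV h (s + of_int n))) = cls (y, s)" for s
    using eq h by (simp add: f_inv_into_f)
  then have "inv_into (topspace Y) f (cls (y, s)) = cls (x, inv_into UNIV h (s + of_int n))" for s
    using bijf x by (metis bij_betw_inv_into_left cls_in)
  then have inv_eq: "(\<lambda>z\<in>topspace Y. inv_into (topspace Y) f z) (cls (y, s))
      = cls (x, inv_into UNIV h (s + of_int n))" for s
    using y by simp
  have "surj (\<lambda>s::real. s + of_int n)" by (rule surjI[of _ "\<lambda>s. s - of_int n"]) simp
  then have "surj (inv_into UNIV h \<circ> (\<lambda>s. s + of_int n))"
    using inv_reparam(2)[OF h] comp_surj by blast
  then have "surj (\<lambda>s. inv_into UNIV h (s + of_int n))" by (simp add: o_def)
  moreover have "strict_mono (\<lambda>s. inv_into UNIV h (s + of_int n))"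
    using inv_reparam(1)[OF h] by (simp add: strict_mono_def)
  ultimately show "\<exists>x\<in>topspace X. \<exists>h::real \<Rightarrow> real. strict_mono h \<and> surj h \<and>
      (\<forall>s. (\<lambda>z\<in>topspace Y. inv_into (topspace Y) f z) (cls (y, s)) = cls (x, h s))"
    using x inv_eq by blast
qed

lemma Homeo_plus_group: "group (Homeo_plus X T)"
proof -
  let ?K = "{f \<in> Bij (topspace Y). continuous_map Y Y f \<and> leafwise f}"
  have "group ((BijGroup (topspace Y)) \<lparr>carrier := ?K\<rparr>)"
  proof (rule Bij_subgroup_is_group)
    have "\<exists>y\<in>topspace X. \<exists>h::real \<Rightarrow> real. strict_mono h \<and> surj h \<and>
        (\<forall>s. (\<lambda>z\<in>topspace Y. z) (cls (x, s)) = cls (y, h s))" if "x \<in> topspace X" for x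
      using that by (intro bexI[of _ x] exI[of _ "\<lambda>s. s"]) (simp_all add: strict_mono_def)
    then have "leafwise (\<lambda>z\<in>topspace Y. z)" unfolding leafwise_def by blast
    moreover have "continuous_map Y Y (\<lambda>z\<in>topspace Y. z)"
      by (rule continuous_map_eq[OF continuous_map_id]) simp
    ultimately show "(\<lambda>z\<in>topspace Y. z) \<in> ?K" by (simp add: id_Bij)
  next
    fix f g assume fg: "f \<in> ?K" "g \<in> ?K"
    then have "continuous_map Y Y (f \<circ> g)" using continuous_map_compose by blast
    then have "continuous_map Y Y (compose (topspace Y) f g)"
      by (rule continuous_map_eq) (simp add: compose_def)
    then show "compose (topspace Y) f g \<in> ?K"
      using fg by (simp add: compose_Bij leafwise_compose)
  next
    fix f assume f: "f \<in> ?K"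
    then have "continuous_map (subtopology Y (topspace Y)) Y (inv_into (topspace Y) f)"
      using continuous_inverse_map[OF compact_Y Hausdorff_Y, of f "inv_into (topspace Y) f" "topspace Y"]
      by (auto simp: Bij_def bij_betw_def)
    then have "continuous_map Y Y (\<lambda>z\<in>topspace Y. inv_into (topspace Y) f z)"
      by (auto intro: continuous_map_eq)
    then show "(\<lambda>z\<in>topspace Y. inv_into (topspace Y) f z) \<in> ?K"
      using f by (simp add: restrict_inv_into_Bij leafwise_inverse)
  qed auto
  moreover have "Homeo_plus X T = (BijGroup (topspace Y)) \<lparr>carrier := ?K\<rparr>"
    using carrier_Homeo_plus by (simp add: Homeo_plus_def)
  ultimately show ?thesis by simp
qed

lemma mult_Homeo_plus:
  "f \<in> carrier (Homeo_plus X T) \<Longrightarrow> g \<in> carrier (Homeo_plus X T)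
    \<Longrightarrow> f \<otimes>\<^bsub>Homeo_plus X T\<^esub> g = compose (topspace Y) f g"
  by (simp add: carrier_Homeo_plus) (simp add: Homeo_plus_def BijGroup_def)

section \<open>The mapping class group\<close>

abbreviation Ymetric where "Ymetric \<equiv> suspension_metric X T"
abbreviation CF where "CF \<equiv> cfunspace Y Ymetric"
abbreviation HT where "HT \<equiv> Homeo_plus_topology X T"

lemma mtopology_suspension_metric: "mtopology_of Ymetric = Y"
proof -
  obtain M d where "Metric_space M d" "Y = Metric_space.mtopology M d"
    using metrizable_Y unfolding metrizable_space_def by blast
  then have "mtopology_of (metric (M, d)) = Y" by (simp add: Metric_space.mtopology_of)
  then show ?thesis unfolding suspension_metric_def by (rule someI)
qed

lemma mspace_suspension_metric: "mspace Ymetric = topspace Y"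
  using mtopology_suspension_metric topspace_mtopology_of by metis

lemma mspace_CF: "f \<in> mspace CF \<longleftrightarrow> f \<in> extensional (topspace Y) \<and> continuous_map Y Y f"
  using compactin_mspace_cfunspace[OF compact_Y[unfolded compact_space_def], of Ymetric]
  by (auto simp: mtopology_suspension_metric mspace_suspension_metric continuous_map_def
      simp del: mspace_cfunspace)

lemma carrier_subset_CF: "carrier (Homeo_plus X T) \<subseteq> mspace CF"
  by (auto simp: carrier_Homeo_plus mspace_CF Bij_def simp del: mspace_cfunspace)

lemma topspace_HT: "topspace HT = carrier (Homeo_plus X T)"
  using carrier_subset_CF unfolding Homeo_plus_topology_def
  by (auto simp del: mspace_cfunspace)

lemma mdist_CF_le:
  assumes "f \<in> mspace CF" "g \<in> mspace CF" "0 \<le> a" "\<And>z. z \<in> topspace Y \<Longrightarrow> mdist Ymetric (f z) (g z) \<le> a"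
  shows "mdist CF f g \<le> a"
  using assms by (intro mdist_cfunspace_le) auto

lemma mdist_le_CF:
  assumes "f \<in> mspace CF" "g \<in> mspace CF" "z \<in> topspace Y"
  shows "mdist Ymetric (f z) (g z) \<le> mdist CF f g"
  using mdist_cfunspace_imp_mdist_le[OF assms(1,2) order_refl assms(3)] .

lemma compose_in_CF:
  assumes "f \<in> mspace CF" "g \<in> mspace CF"
  shows "compose (topspace Y) f g \<in> mspace CF"
proof -
  have "continuous_map Y Y (f \<circ> g)"
    using assms unfolding mspace_CF using continuous_map_compose by blast
  then have "continuous_map Y Y (compose (topspace Y) f g)"
    by (rule continuous_map_eq) (simp add: compose_def)
  then show ?thesis by (simp add: mspace_CF compose_def del: mspace_cfunspace)
qed

lemma CF_maps: "g \<in> mspace CF \<Longrightarrow> z \<in> topspace Y \<Longrightarrow> g z \<in> topspace Y"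
  unfolding mspace_CF by (auto simp: continuous_map_def)

lemma continuous_map_compose_right:
  assumes g: "g \<in> mspace CF"
  shows "continuous_map (mtopology_of CF) (mtopology_of CF) (\<lambda>f. compose (topspace Y) f g)"
proof (rule Lipschitz_continuous_imp_continuous_map)
  have "mdist CF (compose (topspace Y) f g) (compose (topspace Y) f' g) \<le> 1 * mdist CF f f'"
    if "f \<in> mspace CF" "f' \<in> mspace CF" for f f'
    using that g mdist_le_CF CF_maps
    by (intro mdist_CF_le compose_in_CF) (auto simp: compose_def simp del: mspace_cfunspace)
  then show "Lipschitz_continuous_map CF CF (\<lambda>f. compose (topspace Y) f g)"
    unfolding Lipschitz_continuous_map_def using compose_in_CF g by blast
qed

text \<open>Composition with \<open>f\<close> on the right does not increase distances. On the left it respects uniform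
  closeness because \<open>f\<close> is uniformly continuous, the suspension being compact.\<close>

lemma continuous_map_compose_left:
  assumes f: "f \<in> mspace CF"
  shows "continuous_map (mtopology_of CF) (mtopology_of CF) (compose (topspace Y) f)"
proof (rule uniformly_continuous_imp_continuous_map)
  have "uniformly_continuous_map Ymetric Ymetric f"
    using f compact_Y
    by (intro continuous_imp_uniformly_continuous_map)
      (simp add: mtopology_suspension_metric mspace_CF del: mspace_cfunspace)
  then have unif: "\<exists>\<delta>>0. \<forall>x\<in>topspace Y. \<forall>y\<in>topspace Y. mdist Ymetric y x < \<delta> \<longrightarrow> mdist Ymetric (f y) (f x) < \<epsilon>"
    if "\<epsilon> > 0" for \<epsilon>
    using that unfolding uniformly_continuous_map_def mspace_suspension_metric by blast
  show "uniformly_continuous_map CF CF (compose (topspace Y) f)"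
    unfolding uniformly_continuous_map_def
  proof (intro conjI allI impI funcsetI)
    show "compose (topspace Y) f g \<in> mspace CF" if "g \<in> mspace CF" for g
      using f that by (rule compose_in_CF)
    fix \<epsilon> :: real assume "\<epsilon> > 0"
    then obtain \<delta> where \<delta>: "\<delta> > 0"
      "\<And>x y. x \<in> topspace Y \<Longrightarrow> y \<in> topspace Y \<Longrightarrow> mdist Ymetric y x < \<delta> \<Longrightarrow> mdist Ymetric (f y) (f x) < \<epsilon> / 2"
      using unif[of "\<epsilon> / 2"] by auto
    have "mdist CF (compose (topspace Y) f h) (compose (topspace Y) f g) < \<epsilon>"
      if g: "g \<in> mspace CF" and h: "h \<in> mspace CF" and d: "mdist CF h g < \<delta>" for g h
    proof -
      have "mdist CF (compose (topspace Y) f h) (compose (topspace Y) f g) \<le> \<epsilon> / 2"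
      proof (rule mdist_CF_le)
        fix z assume z: "z \<in> topspace Y"
        have "mdist Ymetric (h z) (g z) < \<delta>" using mdist_le_CF[OF h g z] d by simp
        then have "mdist Ymetric (f (h z)) (f (g z)) < \<epsilon> / 2"
          using \<delta>(2) CF_maps[OF g z] CF_maps[OF h z] by blast
        then show "mdist Ymetric (compose (topspace Y) f h z) (compose (topspace Y) f g z) \<le> \<epsilon> / 2"
          using z by (simp add: compose_def)
      qed (use f g h compose_in_CF \<open>\<epsilon> > 0\<close> in auto)
      then show ?thesis using \<open>\<epsilon> > 0\<close> by simp
    qed
    then show "\<exists>\<delta>>0. \<forall>g\<in>mspace CF. \<forall>h\<in>mspace CF. mdist CF h g < \<delta> \<longrightarrow>
        mdist CF (compose (topspace Y) f h) (compose (topspace Y) f g) < \<epsilon>"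
      using \<delta>(1) by blast
  qed
qed

lemma continuous_map_HT:
  assumes "continuous_map (mtopology_of CF) (mtopology_of CF) F"
    and "\<And>f. f \<in> carrier (Homeo_plus X T) \<Longrightarrow> F f \<in> carrier (Homeo_plus X T)"
  shows "continuous_map HT HT F"
  unfolding Homeo_plus_topology_def continuous_map_in_subtopology
  using assms by (auto intro: continuous_map_from_subtopology)

lemma compose_in_carrier:
  assumes "f \<in> carrier (Homeo_plus X T)" "g \<in> carrier (Homeo_plus X T)"
  shows "compose (topspace Y) f g \<in> carrier (Homeo_plus X T)"
  using group.subgroup_self[OF Homeo_plus_group] mult_Homeo_plus[OF assms] assms
  by (metis subgroup.m_closed)

lemma isotopic_in_carrier:
  "path_component_of HT f g \<Longrightarrow> f \<in> carrier (Homeo_plus X T) \<and> g \<in> carrier (Homeo_plus X T)"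
  using path_component_of_equiv[of HT f g] by (simp add: topspace_HT)

text \<open>The path runs from \<open>f \<circ> g\<close> to \<open>f' \<circ> g\<close> and then to \<open>f' \<circ> g'\<close>, so continuity of the product in
  each factor is enough.\<close>

lemma isotopic_compose:
  assumes f: "path_component_of HT f f'" and g: "path_component_of HT g g'"
  shows "path_component_of HT (compose (topspace Y) f g) (compose (topspace Y) f' g')"
proof -
  have in_carrier: "f \<in> carrier (Homeo_plus X T)" "f' \<in> carrier (Homeo_plus X T)"
     "g \<in> carrier (Homeo_plus X T)" "g' \<in> carrier (Homeo_plus X T)"
    using isotopic_in_carrier[OF f] isotopic_in_carrier[OF g] by auto
  then have cont: "continuous_map HT HT (\<lambda>f. compose (topspace Y) f g)"
    "continuous_map HT HT (compose (topspace Y) f')"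
    using carrier_subset_CF compose_in_carrier
    by (blast intro: continuous_map_HT continuous_map_compose_right continuous_map_compose_left)+
  show ?thesis
    using path_component_of_continuous_image[OF cont(1) f] path_component_of_continuous_image[OF cont(2) g]
    by (rule path_component_of_trans)
qed

lemma isotopy_class_eq:
  assumes "path_component_of HT f g"
  shows "isotopy_class X T f = isotopy_class X T g"
proof -
  have "path_component_of HT f = path_component_of HT g"
    using assms path_component_of_equiv[of HT f g] by simp
  then show ?thesis by (simp add: isotopy_class_def)
qed

text \<open>The product of two classes is a union over representatives, which is a single class by
  \<open>isotopic_compose\<close>. That the classes form a group is then inherited from \<^const>\<open>Homeo_plus\<close>.\<close>

lemma isotopy_class_hom:
  "isotopy_class X T \<in> hom (Homeo_plus X T) (mapping_class_group X T)"
proof (rule homI)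
  fix f g assume fg: "f \<in> carrier (Homeo_plus X T)" "g \<in> carrier (Homeo_plus X T)"
  have eq: "isotopy_class X T (f' \<otimes>\<^bsub>Homeo_plus X T\<^esub> g') = isotopy_class X T (f \<otimes>\<^bsub>Homeo_plus X T\<^esub> g)"
    if "f' \<in> isotopy_class X T f" "g' \<in> isotopy_class X T g" for f' g'
  proof -
    have p: "path_component_of HT f f'" "path_component_of HT g g'"
      using that by (auto simp: isotopy_class_def)
    have "f' \<in> carrier (Homeo_plus X T)" "g' \<in> carrier (Homeo_plus X T)"
      using isotopic_in_carrier[OF p(1)] isotopic_in_carrier[OF p(2)] by auto
    then have "path_component_of HT (f \<otimes>\<^bsub>Homeo_plus X T\<^esub> g) (f' \<otimes>\<^bsub>Homeo_plus X T\<^esub> g')"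
      using isotopic_compose[OF p] fg by (simp add: mult_Homeo_plus)
    then show ?thesis by (rule isotopy_class_eq[symmetric])
  qed
  have "f \<in> isotopy_class X T f" "g \<in> isotopy_class X T g"
    using fg by (simp_all add: isotopy_class_def path_component_of_refl topspace_HT)
  then have "isotopy_class X T f \<noteq> {}" "isotopy_class X T g \<noteq> {}" by auto
  then have "(\<Union>f'\<in>isotopy_class X T f. \<Union>g'\<in>isotopy_class X T g.
      isotopy_class X T (f' \<otimes>\<^bsub>Homeo_plus X T\<^esub> g')) = isotopy_class X T (f \<otimes>\<^bsub>Homeo_plus X T\<^esub> g)"
    using eq by (simp cong: SUP_cong)
  then show "isotopy_class X T (f \<otimes>\<^bsub>Homeo_plus X T\<^esub> g)
      = isotopy_class X T f \<otimes>\<^bsub>mapping_class_group X T\<^esub> isotopy_class X T g"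
    by (simp add: mapping_class_group_def)
qed (simp add: mapping_class_group_def)

lemma mapping_class_group_group: "group (mapping_class_group X T)"
  using group.hom_imp_img_group[OF Homeo_plus_group isotopy_class_hom]
  by (simp add: mapping_class_group_def)

text \<open>By the tube lemma, the pointwise estimate \<open>d(F\<^sub>r z, F\<^sub>s z) < \<epsilon>/2\<close> holds for all \<open>z\<close> at once when \<open>r\<close>
  is close to \<open>s\<close>; so joint continuity makes \<open>F\<close> a path for the uniform topology.\<close>

lemma isotopicI:
  fixes F :: "real \<Rightarrow> ('a \<times> real) set \<Rightarrow> ('a \<times> real) set"
  assumes F: "\<And>s. s \<in> {0..1} \<Longrightarrow> F s \<in> carrier (Homeo_plus X T)"
    and cont: "continuous_map (prod_topology (top_of_set {0..1}) Y) Y (\<lambda>(s, z). F s z)"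
  shows "path_component_of HT (F 0) (F 1)"
proof -
  have FCF: "F s \<in> mspace CF" if "s \<in> {0..1}" for s
    using F[OF that] carrier_subset_CF by blast
  let ?I = "top_of_set {0..1::real}"
  have "continuous_map ?I (mtopology_of CF) F"
    unfolding mtopology_of_def Metric_space.continuous_map_to_metric[OF Metric_space_mspace_mdist]
  proof (intro ballI allI impI)
    fix s and \<epsilon> :: real assume "s \<in> topspace ?I" and \<epsilon>: "\<epsilon> > 0"
    then have s: "s \<in> {0..1}" by simp
    let ?P = "prod_topology ?I Y"
    have "continuous_map ?P Y (F s \<circ> snd)"
      using FCF[OF s] unfolding mspace_CF by (auto intro: continuous_map_compose[OF continuous_map_snd])
    then have "continuous_map ?P (mtopology_of Ymetric) (\<lambda>p. F s (snd p))"
      by (simp add: mtopology_suspension_metric o_def)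
    moreover have "continuous_map ?P (mtopology_of Ymetric) (\<lambda>p. F (fst p) (snd p))"
      using cont by (simp add: mtopology_suspension_metric case_prod_unfold)
    ultimately have "continuous_map ?P euclideanreal (\<lambda>p. mdist Ymetric (F (fst p) (snd p)) (F s (snd p)))"
      by (intro continuous_map_mdist)
    then have "openin ?P {p \<in> topspace ?P. mdist Ymetric (F (fst p) (snd p)) (F s (snd p)) \<in> {..<\<epsilon> / 2}}"
      by (rule openin_continuous_map_preimage) simp
    moreover define W where "W = {p \<in> topspace ?P. mdist Ymetric (F (fst p) (snd p)) (F s (snd p)) \<in> {..<\<epsilon> / 2}}"
    ultimately have "openin ?P W" by simp
    moreover have "{s} \<times> topspace Y \<subseteq> W"
    proof clarify
      fix z assume z: "z \<in> topspace Y"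
      have "mdist Ymetric (F s z) (F s z) = 0"
        using CF_maps[OF FCF[OF s] z] by (simp add: mspace_suspension_metric)
      then show "(s, z) \<in> W" using s z \<epsilon> by (simp add: W_def)
    qed
    ultimately have "\<exists>U V. openin ?I U \<and> openin Y V \<and> s \<in> U \<and> topspace Y \<subseteq> V \<and> U \<times> V \<subseteq> W"
      using compact_Y s by (intro tube_lemma_right) (simp_all add: compact_space_def)
    then obtain U where U: "openin ?I U" "s \<in> U" and UV: "U \<times> topspace Y \<subseteq> W" by blast
    have "F r \<in> Metric_space.mball (mspace CF) (mdist CF) (F s) \<epsilon>" if r: "r \<in> U" for r
    proof -
      have r': "r \<in> {0..1}" using openin_subset[OF U(1)] r by auto
      have "mdist CF (F r) (F s) \<le> \<epsilon> / 2"
      proof (rule mdist_CF_le[OF FCF[OF r'] FCF[OF s]])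
        fix z assume "z \<in> topspace Y"
        then have "(r, z) \<in> W" using UV r by blast
        then show "mdist Ymetric (F r z) (F s z) \<le> \<epsilon> / 2" by (simp add: W_def)
      qed (use \<epsilon> in simp)
      then show ?thesis
        using FCF[OF r'] FCF[OF s] \<epsilon> mdist_commute[of CF "F r" "F s"]
        by (simp add: Metric_space.in_mball[OF Metric_space_mspace_mdist] del: mspace_cfunspace)
    qed
    then show "\<exists>U. openin ?I U \<and> s \<in> U \<and> (\<forall>y\<in>U. F y \<in> Metric_space.mball (mspace CF) (mdist CF) (F s) \<epsilon>)"
      using U by blast
  qed
  then have "pathin HT F"
    using F unfolding pathin_def Homeo_plus_topology_def continuous_map_in_subtopology by auto
  then show ?thesis unfolding path_component_of_def by blast
qed

lemma continuous_map_eval: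
  assumes z: "z \<in> topspace Y"
  shows "continuous_map HT Y (\<lambda>f. f z)"
proof -
  have "continuous_map (mtopology_of CF) (mtopology_of Ymetric) (\<lambda>f. f z)"
  proof (rule Lipschitz_continuous_imp_continuous_map)
    show "Lipschitz_continuous_map CF Ymetric (\<lambda>f. f z)"
      unfolding Lipschitz_continuous_map_def
    proof (intro conjI exI[of _ 1] ballI funcsetI)
      show "f z \<in> mspace Ymetric" if "f \<in> mspace CF" for f
        using CF_maps[OF that z] by (simp add: mspace_suspension_metric)
      show "mdist Ymetric (f z) (g z) \<le> 1 * mdist CF f g" if "f \<in> mspace CF" "g \<in> mspace CF" for f g
        using mdist_le_CF[OF that z] by simp
    qed
  qed
  then show ?thesis
    unfolding Homeo_plus_topology_def mtopology_suspension_metric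
    by (rule continuous_map_from_subtopology)
qed

section \<open>Paths in the suspension\<close>

lemma clopen_separation:
  assumes "x \<in> topspace X" "y \<in> topspace X" "x \<noteq> y"
  obtains U where "openin X U" "openin X (topspace X - U)" "x \<in> U" "y \<notin> U"
proof -
  obtain b where b: "homeomorphic_map X (product_topology (\<lambda>_::nat. discrete_topology (UNIV :: bool set)) UNIV) b"
    using Cantor by (auto simp: Cantor_system_def Cantor_set_def homeomorphic_space)
  then have "b x \<noteq> b y"
    using assms by (auto simp: homeomorphic_eq_everything_map inj_on_def)
  then obtain i where i: "b x i \<noteq> b y i" by blast
  have "continuous_map X (discrete_topology UNIV) (\<lambda>x. b x i)"
    using homeomorphic_imp_continuous_map[OF b] by (simp add: continuous_map_componentwise_UNIV)
  then have op: "openin X {z \<in> topspace X. b z i \<in> B}" for B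
    by (rule openin_continuous_map_preimage) simp
  let ?U = "{z \<in> topspace X. b z i \<in> {b x i}}"
  have "topspace X - ?U = {z \<in> topspace X. b z i \<in> - {b x i}}" by auto
  then have "openin X (topspace X - ?U)" using op by metis
  then show ?thesis
    using that[of ?U, OF op[of "{b x i}"]] assms i by simp
qed

lemma Hausdorff_X: "Hausdorff_space X"
  unfolding Hausdorff_space_def
proof (intro allI impI)
  fix x y assume "x \<in> topspace X \<and> y \<in> topspace X \<and> x \<noteq> y"
  then obtain U where "openin X U" "openin X (topspace X - U)" "x \<in> U" "y \<in> topspace X - U"
    using clopen_separation[of x y] by blast
  moreover have "disjnt U (topspace X - U)" by (simp add: disjnt_def)
  ultimately show "\<exists>U V. openin X U \<and> openin X V \<and> x \<in> U \<and> y \<in> V \<and> disjnt U V" by blast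
qed

text \<open>The union of all equivalence classes that meet \<open>U \<times> J\<close> consists of the preimages of \<open>U \<times> J\<close>
  under the homeomorphisms \<open>(x, t) \<mapsto> (T\<^sup>n x, t - n)\<close>.\<close>

lemma openin_box:
  assumes U: "openin X U" and J: "open J"
  shows "openin Y (cls ` (U \<times> J))"
proof -
  let ?XR = "prod_topology X euclideanreal"
  have US: "U \<subseteq> topspace X" using U openin_subset by blast
  let ?shift = "\<lambda>n p. (zpow X T n (fst p), snd p - real_of_int n)"
  have "continuous_map ?XR ?XR (?shift n)" for n
  proof -
    have "continuous_map ?XR X (zpow X T n \<circ> fst)"
      by (rule continuous_map_compose[OF continuous_map_fst continuous_map_zpow[OF homeo]])
    moreover have "continuous_map ?XR euclideanreal (\<lambda>p. snd p - real_of_int n)"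
      by (intro continuous_map_diff continuous_map_snd) simp
    ultimately show ?thesis by (intro continuous_map_pairedI) (simp_all add: o_def)
  qed
  then have "openin ?XR {p \<in> topspace ?XR. ?shift n p \<in> U \<times> J}" for n
    using U J by (intro openin_continuous_map_preimage) (auto simp: openin_prod_Times_iff)
  then have "openin ?XR (\<Union>n. {p \<in> topspace ?XR. ?shift n p \<in> U \<times> J})" by blast
  moreover have "(\<Union>n. {p \<in> topspace ?XR. ?shift n p \<in> U \<times> J})
      = {p \<in> topspace X \<times> UNIV. cls p \<in> cls ` (U \<times> J)}" (is "?L = ?R")
  proof (intro equalityI subsetI)
    fix p assume "p \<in> ?L"
    then obtain n where n: "fst p \<in> topspace X" "?shift n p \<in> U \<times> J" by auto
    then have "cls p = cls (?shift n p)" using cls_zpow[OF n(1), of n] by simp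
    then show "p \<in> ?R" using n by (auto simp: mem_Times_iff)
  next
    fix p assume p: "p \<in> ?R"
    then obtain x t where x: "x \<in> U" "t \<in> J" "cls p = cls (x, t)" by auto
    have p1: "fst p \<in> topspace X" "x \<in> topspace X" using p x(1) US by auto
    obtain n where n: "x = zpow X T n (fst p)" "t = snd p - real_of_int n"
      using cls_eq_iff[OF p1, of "snd p" t] x(3) by auto
    have "?shift n p \<in> U \<times> J" using x(1,2) unfolding n by simp
    then show "p \<in> ?L" using p by auto
  qed
  moreover have "cls ` (U \<times> J) \<subseteq> (topspace X \<times> UNIV) // suspension_rel X T"
    using US topspace_Y topspace_suspension by blast
  ultimately show ?thesis by (simp add: openin_suspension)
qed

text \<open>The leaf is locally constant along a path. At each time the path is in an open flow box
  \<open>X \<times> J\<close> with \<open>J\<close> of length one, in which the \<open>X\<close>-coordinate is well defined. If it took two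
  values on a connected piece of the path inside the box, a clopen set \<open>U\<close> separating them would
  split that piece into two parts, in the disjoint open boxes \<open>U \<times> J\<close> and \<open>(X - U) \<times> J\<close>.\<close>

lemma path_component_in_leaf:
  assumes "path_component_of Y z w"
  shows "leaf z = leaf w"
proof -
  obtain \<gamma> where path: "pathin Y \<gamma>" and ends: "\<gamma> 0 = z" "\<gamma> 1 = w"
    using assms by (auto simp: path_component_of_def)
  let ?I = "top_of_set {0..1::real}"
  have cont: "continuous_map ?I Y \<gamma>" using path by (simp add: pathin_def)
  have loc: "\<exists>V. openin ?I V \<and> a \<in> V \<and> (\<forall>s\<in>V. leaf (\<gamma> a) = leaf (\<gamma> s))" if a: "a \<in> {0..1}" for a
  proof -
    have "\<gamma> a \<in> topspace Y" using cont a by (auto simp: continuous_map_def)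
    then obtain x t where x: "x \<in> topspace X" "\<gamma> a = cls (x, t)" by (rule cls_cases)
    define J where "J = {t - 1/2<..<t + 1/2}"
    have J: "open J" "t \<in> J" by (simp_all add: J_def)
    have small: "n = 0" if "u \<in> J" "u - real_of_int n \<in> J" for u n
    proof -
      have "-1 < real_of_int n" "real_of_int n < 1"
        using that unfolding J_def greaterThanLessThan_iff by linarith+
      then show ?thesis by linarith
    qed
    define W where "W = {s \<in> topspace ?I. \<gamma> s \<in> cls ` (topspace X \<times> J)}"
    have "openin ?I W"
      unfolding W_def using cont openin_box[OF openin_topspace J(1)]
      by (rule openin_continuous_map_preimage)
    moreover have "a \<in> W" unfolding W_def using a x J by simp
    ultimately obtain \<delta> where \<delta>: "\<delta> > 0" and box: "\<And>s. s \<in> {0..1} \<Longrightarrow> dist s a < \<delta> \<Longrightarrow> s \<in> W"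
      unfolding openin_euclidean_subtopology_iff by metis
    define V where "V = {0..1} \<inter> ball a \<delta>"
    have V: "openin ?I V" "a \<in> V" "V \<subseteq> {0..1}"
      using a \<delta> by (auto simp: V_def)
    have "connected V" unfolding V_def by (intro convex_connected convex_Int) simp_all
    have VW: "\<gamma> s \<in> cls ` (topspace X \<times> J)" if "s \<in> V" for s
      using box[of s] that by (simp add: V_def W_def dist_commute)
    have "connectedin Y (\<gamma> ` V)"
      using V(3) \<open>connected V\<close>
      by (intro connectedin_continuous_map_image[OF cont]) (simp add: connectedin_subtopology)
    moreover have "leaf (\<gamma> a) = leaf (\<gamma> s)" if s: "s \<in> V" for s
    proof -
      obtain y u where y: "y \<in> topspace X" "u \<in> J" "\<gamma> s = cls (y, u)" using VW[OF s] by blast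
      have "y = x"
      proof (rule ccontr)
        assume "y \<noteq> x"
        then obtain U where U: "openin X U" "openin X (topspace X - U)" "x \<in> U" "y \<notin> U"
          using clopen_separation[OF x(1) y(1)] by blast
        let ?A = "cls ` (U \<times> J)" and ?B = "cls ` ((topspace X - U) \<times> J)"
        have "?A \<inter> ?B = {}"
        proof (rule ccontr)
          assume "?A \<inter> ?B \<noteq> {}"
          then obtain p q p' q' where pq: "p \<in> U" "q \<in> J" "p' \<in> topspace X - U" "q' \<in> J" "cls (p, q) = cls (p', q')"
            by blast
          then have "p \<in> topspace X" using U(1) openin_subset by blast
          then obtain n where "p' = zpow X T n p" "q' = q - real_of_int n"
            using pq cls_eq_iff[of p p' q q'] by blast
          then show False using small[of q n] pq by auto
        qed
        then have "?A \<inter> ?B \<inter> \<gamma> ` V = {}" by simp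
        moreover have "cls ` (topspace X \<times> J) \<subseteq> ?A \<union> ?B" by blast
        then have "\<gamma> ` V \<subseteq> ?A \<union> ?B" using VW by blast
        moreover have "\<gamma> a \<in> ?A" "\<gamma> s \<in> ?B" using U(3,4) x y J(2) by simp_all
        then have "?A \<inter> \<gamma> ` V \<noteq> {}" "?B \<inter> \<gamma> ` V \<noteq> {}" using V(2) s by blast+
        ultimately show False
          using \<open>connectedin Y (\<gamma> ` V)\<close> openin_box[OF U(1) J(1)] openin_box[OF U(2) J(1)]
          unfolding connectedin by (metis (no_types))
      qed
      then show ?thesis using x y by (simp add: leaf_cls)
    qed
    ultimately show ?thesis using V by blast
  qed
  have "leaf (\<gamma> 0) = leaf (\<gamma> 1)"
  proof (rule connected_equivalence_relation[where S = "{0..1::real}" and R = "\<lambda>a b. leaf (\<gamma> a) = leaf (\<gamma> b)"])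
    show "\<exists>V. openin ?I V \<and> a \<in> V \<and> (\<forall>s\<in>V. leaf (\<gamma> a) = leaf (\<gamma> s))" if "a \<in> {0..1}" for a
      using loc[OF that] .
  qed simp_all
  then show ?thesis using ends by simp
qed

lemma same_leaf_imp_orbit:
  assumes "x \<in> topspace X" "y \<in> topspace X" "leaf (cls (x, t)) = leaf (cls (y, s))"
  obtains n where "y = zpow X T n x"
proof -
  have "cls (y, 0) \<in> range (\<lambda>u. cls (x, u))" using assms by (simp add: leaf_cls)
  then obtain u where "cls (x, u) = cls (y, 0)" by auto
  then show ?thesis using that cls_eq_iff[OF assms(1,2)] by blast
qed

end

section \<open>Interpolating integer sequences\<close>

text \<open>The piecewise linear function through the points \<open>(n, a n)\<close>.\<close>

definition interpolate :: "(int \<Rightarrow> real) \<Rightarrow> real \<Rightarrow> real" where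
  "interpolate a u = a \<lfloor>u\<rfloor> + frac u * (a (\<lfloor>u\<rfloor> + 1) - a \<lfloor>u\<rfloor>)"

lemma interpolate_shift: "interpolate (\<lambda>k. a (k + n) - c) u = interpolate a (u + of_int n) - c"
  by (simp add: interpolate_def frac_def add.commute add.left_commute)

lemma step_growth:
  fixes a :: "int \<Rightarrow> real"
  assumes "\<And>n. a (n + 1) \<ge> a n + 1" "m \<le> n"
  shows "a m + of_int (n - m) \<le> a n"
  using assms(2)
proof (induction n rule: int_ge_induct)
  case base
  show ?case by simp
next
  case (step i)
  then show ?case using assms(1)[of i] by simp
qed

lemma interpolate_bounds:
  assumes a: "\<And>n. a (n + 1) \<ge> a n + 1"
  shows "a \<lfloor>u\<rfloor> \<le> interpolate a u" "interpolate a u < a (\<lfloor>u\<rfloor> + 1)"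
proof -
  have pos: "a (\<lfloor>u\<rfloor> + 1) - a \<lfloor>u\<rfloor> > 0" using a[of "\<lfloor>u\<rfloor>"] by simp
  then show "a \<lfloor>u\<rfloor> \<le> interpolate a u" by (simp add: interpolate_def)
  have "frac u * (a (\<lfloor>u\<rfloor> + 1) - a \<lfloor>u\<rfloor>) < 1 * (a (\<lfloor>u\<rfloor> + 1) - a \<lfloor>u\<rfloor>)"
    using pos frac_lt_1 by (intro mult_strict_right_mono)
  then show "interpolate a u < a (\<lfloor>u\<rfloor> + 1)" by (simp add: interpolate_def)
qed

lemma strict_mono_interpolate:
  assumes a: "\<And>n. a (n + 1) \<ge> a n + 1"
  shows "strict_mono (interpolate a)"
proof (rule strict_monoI)
  fix u v :: real assume uv: "u < v"
  show "interpolate a u < interpolate a v"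
  proof (cases "\<lfloor>u\<rfloor> = \<lfloor>v\<rfloor>")
    case True
    then have "frac u < frac v" using uv by (simp add: frac_def)
    moreover have "a (\<lfloor>u\<rfloor> + 1) - a \<lfloor>u\<rfloor> > 0" using a[of "\<lfloor>u\<rfloor>"] by simp
    ultimately show ?thesis using True by (simp add: interpolate_def)
  next
    case False
    then have "\<lfloor>u\<rfloor> + 1 \<le> \<lfloor>v\<rfloor>" using uv floor_mono[of u v] by linarith
    then have "a (\<lfloor>u\<rfloor> + 1) \<le> a \<lfloor>v\<rfloor>" using step_growth[of a, OF a, of "\<lfloor>u\<rfloor> + 1" "\<lfloor>v\<rfloor>"] by simp
    then show ?thesis using interpolate_bounds[of a, OF a] by (meson less_le_trans order_less_le_trans)
  qed
qed

lemma surj_interpolate: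
  assumes a: "\<And>n. a (n + 1) \<ge> a n + 1"
  shows "surj (interpolate a)"
proof -
  have "\<exists>u. interpolate a u = y" for y
  proof -
    \<comment> \<open>The required piece starts at the last \<open>n\<close> with \<open>a n \<le> y\<close>. As \<open>a\<close> grows by at least \<open>1\<close> per
      step, this \<open>n\<close> lies between \<open>0\<close> and \<open>k\<close>.\<close>
    define k where "k = \<lfloor>y - a 0\<rfloor>"
    let ?A = "{n \<in> {min 0 k..max 0 k}. a n \<le> y}"
    have low: "a (min 0 k) \<le> y"
    proof (cases "k \<ge> 0")
      case True
      then show ?thesis by (simp add: k_def)
    next
      case False
      then have "a k \<le> a 0 + of_int k" using step_growth[of a, OF a, of k 0] by simp
      also have "\<dots> \<le> y" unfolding k_def using of_int_floor_le[of "y - a 0"] by linarith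
      finally show ?thesis using False by simp
    qed
    have A: "finite ?A" "?A \<noteq> {}"
    proof -
      show "finite ?A" by (rule finite_subset[of _ "{min 0 k..max 0 k}"]) auto
      have "min 0 k \<in> ?A" using low by simp
      then show "?A \<noteq> {}" by blast
    qed
    define n where "n = Max ?A"
    have n: "n \<in> ?A" unfolding n_def by (rule Max_in[OF A])
    have "y < a (n + 1)"
    proof (rule ccontr)
      assume "\<not> y < a (n + 1)"
      then have le: "a (n + 1) \<le> y" by simp
      have "n + 1 \<le> max 0 k"
      proof (rule ccontr)
        assume "\<not> n + 1 \<le> max 0 k"
        then have "n + 1 = max 0 k + 1" using n by auto
        then have "n + 1 \<ge> k + 1" "n + 1 \<ge> 0" by auto
        then have "a 0 + of_int (k + 1) \<le> a (n + 1)" using step_growth[of a, OF a, of 0 "n + 1"] by simp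
        then have "of_int (k + 1) \<le> y - a 0" using le by simp
        then have "k + 1 \<le> k" unfolding k_def by (simp only: le_floor_iff)
        then show False by simp
      qed
      then have "n + 1 \<in> ?A" using n le by simp
      then have "n + 1 \<le> n" unfolding n_def using A(1) by (rule Max_ge[rotated])
      then show False by simp
    qed
    define f where "f = (y - a n) / (a (n + 1) - a n)"
    have pos: "a (n + 1) - a n > 0" using a[of n] by simp
    have f: "0 \<le> f" "f < 1" using n \<open>y < a (n + 1)\<close> pos by (auto simp: f_def)
    have fl: "\<lfloor>of_int n + f\<rfloor> = n" using f by (simp add: floor_eq_iff)
    then have "interpolate a (of_int n + f) = a n + f * (a (n + 1) - a n)"
      by (simp add: interpolate_def frac_def)
    also have "\<dots> = y" using pos by (simp add: f_def)
    finally show ?thesis by blast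
  qed
  then show ?thesis by (metis surj_def)
qed

section \<open>The return system of a cross section\<close>

locale cross_section = aperiodic_system +
  fixes C :: "'a set"
  assumes dcs: "discrete_cross_section X T C"
begin

abbreviation r where "r \<equiv> return_time T C"
abbreviation R where "R \<equiv> return_map T C"
abbreviation Cs where "Cs \<equiv> subtopology X C"

lemma C_open: "openin X C" and C_closed: "closedin X C"
  and r_cont: "continuous_map Cs (discrete_topology UNIV) r"
  and X_eq: "topspace X = {(T ^^ i) x |x i. x \<in> C}"
  using dcs by (auto simp: discrete_cross_section_def)

lemma C_in [simp, intro]: "x \<in> C \<Longrightarrow> x \<in> topspace X"
  using C_open openin_subset by blast

lemma topspace_Int_C [simp]: "topspace X \<inter> C = C"
  by auto

lemma r_ge_1: "x \<in> C \<Longrightarrow> 1 \<le> r x" and r_in: "x \<in> C \<Longrightarrow> (T ^^ r x) x \<in> C"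
proof -
  assume "x \<in> C"
  then have "\<exists>i. 1 \<le> i \<and> (T ^^ i) x \<in> C" using dcs by (auto simp: discrete_cross_section_def)
  from LeastI_ex[OF this] show "1 \<le> r x" "(T ^^ r x) x \<in> C" by (auto simp: return_time_def)
qed

lemma r_le: "1 \<le> i \<Longrightarrow> (T ^^ i) x \<in> C \<Longrightarrow> r x \<le> i"
  unfolding return_time_def by (rule Least_le) simp

lemma R_eq: "x \<in> C \<Longrightarrow> R x = (T ^^ r x) x"
  by (simp add: return_map_def)

lemma R_in: "x \<in> C \<Longrightarrow> R x \<in> C"
  by (simp add: R_eq r_in)

lemma R_eq_zpow: "x \<in> C \<Longrightarrow> R x = zpow X T (int (r x)) x"
  by (simp add: R_eq zpow_of_nat)

lemma R_inj: "inj_on R C"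
proof -
  have aux: "x = y" if "x \<in> C" "y \<in> C" "R x = R y" "r x \<le> r y" for x y
  proof -
    have "zpow X T (int (r x)) x = zpow X T (int (r x) + (int (r y) - int (r x))) y"
      using that by (simp add: R_eq_zpow)
    also have "\<dots> = zpow X T (int (r x)) (zpow X T (int (r y) - int (r x)) y)"
      using that by (intro zpow_add[OF bij]) auto
    finally have x: "x = zpow X T (int (r y) - int (r x)) y"
      using that by (subst (asm) zpow_cancel) auto
    then have xT: "x = (T ^^ (r y - r x)) y"
      using that(4) by (metis of_nat_diff zpow_of_nat)
    show ?thesis
    proof (cases "r y - r x = 0")
      case True
      then show ?thesis using xT by simp
    next
      case False
      then have "r y \<le> r y - r x" using r_le[of "r y - r x" y] xT that(1) by simp
      then show ?thesis using r_ge_1[OF that(1)] that(4) by linarith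
    qed
  qed
  show ?thesis
  proof (rule inj_onI)
    fix x y assume "x \<in> C" "y \<in> C" "R x = R y"
    then show "x = y" using aux[of x y] aux[of y x] by (cases "r x \<le> r y") auto
  qed
qed

text \<open>The preimage of \<open>y\<close> is the first point of \<open>C\<close> on the backward orbit of \<open>y\<close>. There is such a
  point because the forward translates of \<open>C\<close> cover \<open>X\<close>.\<close>

lemma R_surj: "R ` C = C"
proof
  show "R ` C \<subseteq> C" using R_in by blast
  show "C \<subseteq> R ` C"
  proof
    fix y assume y: "y \<in> C"
    have pre: "zpow X T (- 1) y \<in> topspace X" using y by simp
    then obtain x i where x: "x \<in> C" "zpow X T (- 1) y = (T ^^ i) x" using X_eq by blast
    have "zpow X T (- int (Suc i)) y = x"
    proof -
      have "y = zpow X T 1 (zpow X T (- 1) y)"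
        using zpow_add[OF bij C_in[OF y], of 1 "- 1"] by (simp del: zpow_one)
      also have "\<dots> = zpow X T 1 (zpow X T (int i) x)" unfolding x(2) zpow_of_nat ..
      also have "\<dots> = zpow X T (int (Suc i)) x"
        using zpow_add[OF bij C_in[OF x(1)], of 1 "int i"] by (simp del: zpow_one)
      finally have "y = zpow X T (int (Suc i)) x" .
      then show ?thesis using zpow_uminus[OF bij C_in[OF x(1)], of "int (Suc i)"] by simp
    qed
    then have "1 \<le> Suc i \<and> zpow X T (- int (Suc i)) y \<in> C" using x(1) by simp
    then have ex: "\<exists>j. 1 \<le> j \<and> zpow X T (- int j) y \<in> C" by (rule exI)
    define j where "j = (LEAST j. 1 \<le> j \<and> zpow X T (- int j) y \<in> C)"
    have j: "1 \<le> j" "zpow X T (- int j) y \<in> C"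
      using LeastI_ex[OF ex] unfolding j_def[symmetric] by auto
    have j_least: "j \<le> i" if "1 \<le> i" "zpow X T (- int i) y \<in> C" for i
    proof -
      have "1 \<le> i \<and> zpow X T (- int i) y \<in> C" using that by (rule conjI)
      then show ?thesis unfolding j_def by (rule Least_le)
    qed
    let ?x = "zpow X T (- int j) y"
    have shift: "(T ^^ i) ?x = zpow X T (int i - int j) y" for i
      using zpow_add[OF bij C_in[OF y], of "int i" "- int j"] by (simp add: zpow_of_nat)
    have "r ?x \<le> j" using r_le[of j ?x] j y by (simp add: shift)
    moreover have "\<not> r ?x < j"
    proof
      assume lt: "r ?x < j"
      have eq: "int (r ?x) - int j = - int (j - r ?x)" using lt by simp
      have "zpow X T (int (r ?x) - int j) y \<in> C" using r_in[OF j(2)] unfolding shift .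
      then have "zpow X T (- int (j - r ?x)) y \<in> C" unfolding eq .
      moreover have "1 \<le> j - r ?x" using lt by simp
      ultimately have "j \<le> j - r ?x" using j_least by metis
      then show False using r_ge_1[OF j(2)] lt by linarith
    qed
    ultimately have "R ?x = y" using shift[of j] R_eq[OF j(2)] by simp
    then show "y \<in> R ` C" using j(2) by (metis imageI)
  qed
qed

lemma bij_R: "bij_betw R (topspace Cs) (topspace Cs)"
  using R_inj R_surj by (simp add: bij_betw_def)

lemma compact_Cs: "compact_space Cs"
  using C_closed compact_X closedin_compact_space compact_space_subtopology by blast

lemma Hausdorff_Cs: "Hausdorff_space Cs"
  using Hausdorff_X by (rule Hausdorff_space_subtopology)

text \<open>On the clopen set where \<open>r\<close> has the value \<open>k\<close>, the return map is \<open>T\<^sup>k\<close>.\<close>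

lemma continuous_R: "continuous_map Cs Cs R"
proof -
  have "continuous_map Cs X R"
    unfolding continuous_map_def
  proof (intro conjI allI impI)
    show "R \<in> topspace Cs \<rightarrow> topspace X" using R_in by auto
    fix V assume V: "openin X V"
    have "continuous_map Cs X (T ^^ k)" for k
      using continuous_map_zpow[OF homeo, of "int k"] by (simp add: zpow_of_nat continuous_map_from_subtopology)
    then have "openin Cs ({x \<in> topspace Cs. r x \<in> {k}} \<inter> {x \<in> topspace Cs. (T ^^ k) x \<in> V})" for k
      using V r_cont by (intro openin_Int openin_continuous_map_preimage) auto
    then have "openin Cs (\<Union>k. {x \<in> topspace Cs. r x \<in> {k}} \<inter> {x \<in> topspace Cs. (T ^^ k) x \<in> V})"
      by blast
    moreover have "(\<Union>k. {x \<in> topspace Cs. r x \<in> {k}} \<inter> {x \<in> topspace Cs. (T ^^ k) x \<in> V})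
        = {x \<in> topspace Cs. R x \<in> V}"
      by (auto simp: R_eq)
    ultimately show "openin Cs {x \<in> topspace Cs. R x \<in> V}" by simp
  qed
  then show ?thesis using R_in by (auto simp: continuous_map_in_subtopology)
qed

lemma homeo_R: "homeomorphic_map Cs Cs R"
  using continuous_imp_homeomorphic_map[OF continuous_R compact_Cs Hausdorff_Cs] R_surj R_inj by simp

abbreviation rp where "rp \<equiv> zpow Cs R"

lemma rp_in [simp, intro]: "x \<in> C \<Longrightarrow> rp n x \<in> C"
  using zpow_in_topspace[OF bij_R] by simp

lemma rp_succ: "x \<in> C \<Longrightarrow> rp (n + 1) x = R (rp n x)"
  using zpow_succ[OF bij_R] by simp

lemma rp_add: "x \<in> C \<Longrightarrow> rp (m + n) x = rp m (rp n x)"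
  using zpow_add[OF bij_R] by simp

lemma rp_is_zpow: "x \<in> C \<Longrightarrow> \<exists>m. zpow X T m x = rp n x"
proof (induction n rule: int_induct[where k = 0])
  case base
  show ?case by (intro exI[of _ 0]) simp
next
  case (step1 i)
  then obtain m where m: "zpow X T m x = rp i x" by blast
  have "rp (i + 1) x = zpow X T (int (r (rp i x))) (zpow X T m x)"
    using step1 by (simp add: rp_succ R_eq_zpow m)
  then show ?case using zpow_add[OF bij C_in[OF step1(3)]] by metis
next
  case (step2 i)
  then obtain m where m: "zpow X T m x = rp i x" by blast
  let ?y = "rp (i - 1) x"
  have y: "?y \<in> C" using step2 by simp
  have "zpow X T m x = zpow X T (int (r ?y)) ?y"
    using rp_succ[of x "i - 1"] step2 m R_eq_zpow[OF y] by simp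
  then have "?y = zpow X T (- int (r ?y)) (zpow X T m x)"
    using zpow_uminus[OF bij C_in[OF y]] by metis
  then show ?case using zpow_add[OF bij C_in[OF step2(3)]] by metis
qed

text \<open>Forward in time, an orbit visits \<open>C\<close> only at its successive returns, by induction on the time
  that is left after the first return. For negative times exchange the two points.\<close>

lemma zpow_is_rp:
  assumes "x \<in> C" "zpow X T m x \<in> C"
  shows "\<exists>n. zpow X T m x = rp n x"
proof -
  have pos: "\<exists>n. (T ^^ k) x = rp n x" if "x \<in> C" "(T ^^ k) x \<in> C" for k x
    using that
  proof (induction k arbitrary: x rule: less_induct)
    case (less k)
    show ?case
    proof (cases "k = 0")
      case True
      then show ?thesis by (intro exI[of _ 0]) simp
    next
      case False
      then have le: "r x \<le> k" using r_le less.prems by simp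
      have "(T ^^ ((k - r x) + r x)) x = (T ^^ (k - r x)) ((T ^^ r x) x)"
        by (simp only: funpow_add o_apply)
      then have eq: "(T ^^ k) x = (T ^^ (k - r x)) (R x)"
        using le less.prems R_eq by simp
      have "\<exists>n. (T ^^ (k - r x)) (R x) = rp n (R x)"
        using less.IH[of "k - r x" "R x"] less.prems r_ge_1[of x] False eq R_in by simp
      then obtain n where "(T ^^ k) x = rp n (R x)" using eq by auto
      then have "(T ^^ k) x = rp (n + 1) x" using rp_add[of x n 1] less.prems by simp
      then show ?thesis by blast
    qed
  qed
  show ?thesis
  proof (cases "m \<ge> 0")
    case True
    then show ?thesis using pos[of x "nat m"] assms by (simp add: zpow_def)
  next
    case False
    let ?y = "zpow X T m x"
    have x: "x = (T ^^ nat (- m)) ?y"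
      using zpow_uminus[OF bij C_in[OF assms(1)], of m] False zpow_of_nat[of X T "nat (- m)"] by simp
    then obtain n where "x = rp n ?y" using pos[OF assms(2), of "nat (- m)"] assms(1) by auto
    then have "?y = rp (- n) x" using zpow_uminus[OF bij_R, of ?y n] assms(2) by simp
    then show ?thesis by blast
  qed
qed

text \<open>The time of the \<open>n\<close>-th return to \<open>C\<close>; by aperiodicity the point of arrival determines it. This
  definition treats negative \<open>n\<close> alike and makes the cocycle rule a matter of uniqueness.\<close>

definition \<tau> :: "'a \<Rightarrow> int \<Rightarrow> int" where
  "\<tau> x n = (THE m. zpow X T m x = rp n x)"

lemma tau_unique: "x \<in> C \<Longrightarrow> zpow X T m x = rp n x \<Longrightarrow> \<tau> x n = m"
  unfolding \<tau>_def using zpow_inj[of x] by (intro the_equality) auto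

lemma zpow_tau: "x \<in> C \<Longrightarrow> zpow X T (\<tau> x n) x = rp n x"
  using rp_is_zpow[of x n] tau_unique by metis

lemma tau_succ: "x \<in> C \<Longrightarrow> \<tau> x (n + 1) = \<tau> x n + int (r (rp n x))"
proof (rule tau_unique)
  assume x: "x \<in> C"
  have "zpow X T (\<tau> x n + int (r (rp n x))) x = zpow X T (int (r (rp n x))) (zpow X T (\<tau> x n) x)"
    using zpow_add[OF bij C_in[OF x]] by (metis add.commute)
  then show "zpow X T (\<tau> x n + int (r (rp n x))) x = rp (n + 1) x"
    using x by (simp add: zpow_tau rp_succ R_eq_zpow)
qed

lemma tau_cocycle: "x \<in> C \<Longrightarrow> \<tau> (rp n x) k = \<tau> x (k + n) - \<tau> x n"
proof (rule tau_unique)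
  assume x: "x \<in> C"
  show "rp n x \<in> C" using x by simp
  have "zpow X T (\<tau> x (k + n) - \<tau> x n) (rp n x) = zpow X T (\<tau> x (k + n) - \<tau> x n) (zpow X T (\<tau> x n) x)"
    using x by (simp add: zpow_tau)
  also have "\<dots> = zpow X T (\<tau> x (k + n)) x"
    using zpow_add[OF bij C_in[OF x], of "\<tau> x (k + n) - \<tau> x n" "\<tau> x n"] by simp
  also have "\<dots> = rp k (rp n x)" using x by (simp add: zpow_tau rp_add)
  finally show "zpow X T (\<tau> x (k + n) - \<tau> x n) (rp n x) = rp k (rp n x)" .
qed

lemma tau_0: "x \<in> C \<Longrightarrow> \<tau> x 0 = 0"
  by (rule tau_unique) simp_all

text \<open>The change of time on the leaf of \<open>x\<close> after which every return takes one unit.\<close>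

definition L :: "'a \<Rightarrow> real \<Rightarrow> real" where
  "L x = interpolate (\<lambda>n. of_int (\<tau> x n))"

lemma tau_step: "x \<in> C \<Longrightarrow> real_of_int (\<tau> x (n + 1)) \<ge> real_of_int (\<tau> x n) + 1"
  using tau_succ[of x n] r_ge_1[of "rp n x"] by simp

lemma L_strict_mono: "x \<in> C \<Longrightarrow> strict_mono (L x)"
  unfolding L_def by (rule strict_mono_interpolate) (rule tau_step)

lemma L_surj: "x \<in> C \<Longrightarrow> surj (L x)"
  unfolding L_def by (rule surj_interpolate) (rule tau_step)

lemma L_rp: "x \<in> C \<Longrightarrow> L (rp n x) u = L x (u + of_int n) - of_int (\<tau> x n)"
  using interpolate_shift[of "\<lambda>n. of_int (\<tau> x n)" n "of_int (\<tau> x n)" u]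
  by (simp add: L_def tau_cocycle)

lemma L_unit:
  assumes x: "x \<in> C" and u: "0 \<le> u" "u \<le> 1"
  shows "L x u = u * real (r x)"
proof (cases "u = 1")
  case True
  then show ?thesis using tau_succ[OF x, of 0] tau_0[OF x] by (simp add: L_def interpolate_def)
next
  case False
  then have "\<lfloor>u\<rfloor> = 0" using u by (simp add: floor_eq_iff)
  then show ?thesis
    using tau_succ[OF x, of 0] tau_0[OF x] by (simp add: L_def interpolate_def frac_def)
qed

text \<open>The suspension of \<open>R\<close> as a coordinate on the suspension of \<open>T\<close>: at time \<open>n\<close> the curve
  \<open>u \<mapsto> \<Theta> (x, u)\<close> passes through the \<open>n\<close>-th return of \<open>x\<close>, and it is linear in between.\<close>

definition \<Theta> :: "'a \<times> real \<Rightarrow> ('a \<times> real) set" where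
  "\<Theta> p = cls (fst p, L (fst p) (snd p))"

lemma Theta_rp: "x \<in> C \<Longrightarrow> \<Theta> (rp n x, u) = \<Theta> (x, u + of_int n)"
proof -
  assume x: "x \<in> C"
  have "cls (rp n x, t) = cls (x, t + of_int (\<tau> x n))" for t
    using cls_zpow[OF C_in[OF x], of "\<tau> x n" t] by (simp add: zpow_tau[OF x])
  then show ?thesis using x by (simp add: \<Theta>_def L_rp)
qed

lemma Theta_in [simp, intro]: "x \<in> C \<Longrightarrow> \<Theta> (x, u) \<in> topspace Y"
  by (simp add: \<Theta>_def)

text \<open>Conversely to \<open>Theta_rp\<close>, nothing is identified beyond what the suspension of \<open>R\<close> requires: a
  leaf meets \<open>C\<close> in a single \<open>R\<close>-orbit, and \<open>L x\<close> is injective.\<close>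

lemma Theta_eqE:
  assumes xy: "x \<in> C" "y \<in> C" and eq: "\<Theta> (x, u) = \<Theta> (y, v)"
  obtains n where "y = rp n x" "v = u - of_int n"
proof -
  obtain m where m: "y = zpow X T m x"
    using eq cls_eq_iff[OF C_in[OF xy(1)] C_in[OF xy(2)]] by (auto simp: \<Theta>_def)
  then obtain n where n: "y = rp n x" using zpow_is_rp[OF xy(1)] xy(2) by metis
  then have "\<Theta> (x, u) = \<Theta> (x, v + of_int n)" using eq Theta_rp[OF xy(1)] by simp
  then have "L x u = L x (v + of_int n)" using xy cls_inj by (simp add: \<Theta>_def)
  then have "u = v + of_int n"
    using L_strict_mono[OF xy(1)] by (simp add: strict_mono_eq)
  then show ?thesis using that n by simp
qed

lemma Theta_cover: "topspace Y = \<Theta> ` (C \<times> {0..1})"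
proof
  show "\<Theta> ` (C \<times> {0..1}) \<subseteq> topspace Y" by auto
  show "topspace Y \<subseteq> \<Theta> ` (C \<times> {0..1})"
  proof
    fix z assume "z \<in> topspace Y"
    then obtain x t where xt: "x \<in> topspace X" "z = cls (x, t)" by (rule cls_cases)
    then obtain y i where y: "y \<in> C" "x = (T ^^ i) y" using X_eq by blast
    then have "z = cls (y, t + of_int (int i))"
      using cls_zpow[OF C_in[OF y(1)], of "int i" t] xt by (simp add: zpow_of_nat)
    moreover obtain u where "t + of_int (int i) = L y u" using L_surj[OF y(1)] by (metis surjE)
    ultimately have "z = \<Theta> (y, u)" by (simp add: \<Theta>_def)
    also have "\<dots> = \<Theta> (rp \<lfloor>u\<rfloor> y, frac u)" using y(1) by (simp add: Theta_rp frac_def)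
    finally show "z \<in> \<Theta> ` (C \<times> {0..1})"
      using y(1) frac_lt_1[of u] by (auto intro!: image_eqI[of _ _ "(rp \<lfloor>u\<rfloor> y, frac u)"])
  qed
qed

lemma Theta_cases:
  assumes "z \<in> topspace Y"
  obtains x u where "x \<in> C" "0 \<le> u" "u \<le> 1" "z = \<Theta> (x, u)"
  using assms unfolding Theta_cover by auto

text \<open>For \<open>k \<le> u \<le> k + 1\<close> the rule \<open>\<Theta> (x, u) = \<Theta> (R\<^sup>k x, u - k)\<close> leads back to the segment over a
  point of \<open>C\<close>, where \<open>\<Theta>\<close> is given by a formula in the continuous function \<open>r\<close>.\<close>

lemma continuous_Theta: "continuous_map (prod_topology Cs euclideanreal) Y \<Theta>"
proof (rule continuous_map_by_unit_intervals)
  let ?P = "prod_topology Cs euclideanreal"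
  fix k :: int
  have rp: "continuous_map ?P Cs (\<lambda>p. rp k (fst p))"
    using continuous_map_compose[OF continuous_map_fst continuous_map_zpow[OF homeo_R]] by (simp add: o_def)
  have "continuous_map Cs euclideanreal (\<lambda>x. real (r x))"
    using continuous_map_compose[OF r_cont, of euclideanreal real] by (simp add: o_def)
  from continuous_map_compose[OF rp this]
  have "continuous_map ?P euclideanreal (\<lambda>p. (snd p - of_int k) * real (r (rp k (fst p))))"
    by (intro continuous_map_real_mult continuous_map_diff continuous_map_snd) (simp_all add: o_def)
  moreover have "continuous_map ?P X (\<lambda>p. rp k (fst p))"
    using rp by (simp add: continuous_map_in_subtopology)
  ultimately have "continuous_map ?P (prod_topology X euclideanreal)
      (\<lambda>p. (rp k (fst p), (snd p - of_int k) * real (r (rp k (fst p)))))"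
    by (intro continuous_map_pairedI)
  from continuous_map_compose[OF this continuous_map_cls]
  have "continuous_map ?P Y (\<lambda>p. cls (rp k (fst p), (snd p - of_int k) * real (r (rp k (fst p)))))"
    by (simp add: o_def)
  then show "continuous_map (subtopology ?P (topspace Cs \<times> {of_int k..of_int k + 1})) Y
      (\<lambda>p. cls (rp k (fst p), (snd p - of_int k) * real (r (rp k (fst p)))))"
    by (rule continuous_map_from_subtopology)
next
  have piece: "\<Theta> (x, u) = cls (rp k x, (u - of_int k) * real (r (rp k x)))"
    if "x \<in> C" "of_int k \<le> u" "u \<le> of_int k + 1" for x u k
  proof -
    have "\<Theta> (x, u) = \<Theta> (rp k x, u - of_int k)" using that by (simp add: Theta_rp)
    also have "\<dots> = cls (rp k x, (u - of_int k) * real (r (rp k x)))"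
      using that L_unit[of "rp k x" "u - of_int k"] by (simp add: \<Theta>_def)
    finally show ?thesis .
  qed
  show "(\<lambda>p. cls (rp k (fst p), (snd p - of_int k) * real (r (rp k (fst p))))) (x, of_int k + 1)
      = (\<lambda>p. cls (rp (k + 1) (fst p), (snd p - of_int (k + 1)) * real (r (rp (k + 1) (fst p))))) (x, of_int k + 1)"
    if "x \<in> topspace Cs" for k x
    using piece[of x k "of_int k + 1"] piece[of x "k + 1" "of_int k + 1"] that by simp
  show "\<Theta> (x, u) = (\<lambda>p. cls (rp \<lfloor>u\<rfloor> (fst p), (snd p - of_int \<lfloor>u\<rfloor>) * real (r (rp \<lfloor>u\<rfloor> (fst p))))) (x, u)"
    if "x \<in> topspace Cs" for x u
    using piece[of x "\<lfloor>u\<rfloor>" u] that by simp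
qed

section \<open>Lifting automorphisms\<close>

abbreviation Aut where "Aut \<equiv> Aut_group Cs R"

lemma Aut_group_Aut: "group Aut"
  using R_in by (intro Aut_group_group) simp

lemma AutD:
  assumes "\<phi> \<in> carrier Aut"
  shows "\<phi> \<in> extensional C" "bij_betw \<phi> C C" "continuous_map Cs Cs \<phi>"
    "x \<in> C \<Longrightarrow> \<phi> x \<in> C" "x \<in> C \<Longrightarrow> \<phi> (R x) = R (\<phi> x)"
  using assms
  by (auto simp: Aut_group_def Bij_def homeomorphic_imp_continuous_map bij_betw_apply)

lemma Aut_rp:
  assumes "\<phi> \<in> carrier Aut" "x \<in> C"
  shows "\<phi> (rp n x) = rp n (\<phi> x)"
  using assms AutD[OF assms(1)] by (intro zpow_commute bij_R) auto

lemma R_in_Aut: "R \<in> carrier Aut"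
  using R_in homeo_R bij_R by (auto simp: Aut_group_def Bij_def return_map_def)

text \<open>The map \<open>(x, u) \<mapsto> (\<phi> x, u + s)\<close> in the coordinate \<open>\<Theta>\<close>. The choice of the representative
  is immaterial because \<open>\<phi>\<close> commutes with \<open>R\<close>. Time \<open>s = 0\<close> gives \<open>S\<^sub>\<phi>\<close>, and \<open>\<phi> = id\<close> the flow of
  the suspension of \<open>R\<close>.\<close>

definition shift_lift :: "('a \<Rightarrow> 'a) \<Rightarrow> real \<Rightarrow> ('a \<times> real) set \<Rightarrow> ('a \<times> real) set" where
  "shift_lift \<phi> s = (\<lambda>z\<in>topspace Y. let p = (SOME p. fst p \<in> C \<and> z = \<Theta> p) in \<Theta> (\<phi> (fst p), snd p + s))"

lemma shift_lift_Theta: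
  assumes \<phi>: "\<phi> \<in> carrier Aut" and x: "x \<in> C"
  shows "shift_lift \<phi> s (\<Theta> (x, u)) = \<Theta> (\<phi> x, u + s)"
proof -
  define p where "p = (SOME p. fst p \<in> C \<and> \<Theta> (x, u) = \<Theta> p)"
  have "\<exists>p. fst p \<in> C \<and> \<Theta> (x, u) = \<Theta> p" using x by (intro exI[of _ "(x, u)"]) simp
  from someI_ex[OF this] have p: "fst p \<in> C" "\<Theta> (x, u) = \<Theta> (fst p, snd p)"
    unfolding p_def[symmetric] by simp_all
  obtain n where n: "fst p = rp n x" "snd p = u - of_int n" using Theta_eqE[OF x p] .
  have "\<Theta> (\<phi> (fst p), snd p + s) = \<Theta> (rp n (\<phi> x), u - of_int n + s)"
    using n Aut_rp[OF \<phi> x] by simp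
  also have "\<dots> = \<Theta> (\<phi> x, u + s)"
    using Theta_rp[OF AutD(4)[OF \<phi> x]] by simp
  finally show ?thesis
    using x unfolding shift_lift_def by (simp add: Let_def p_def)
qed

lemma shift_lift_eqI:
  assumes \<phi>: "\<phi> \<in> carrier Aut" and f: "f \<in> extensional (topspace Y)"
    and eq: "\<And>x u. x \<in> C \<Longrightarrow> f (\<Theta> (x, u)) = \<Theta> (\<phi> x, u + s)"
  shows "f = shift_lift \<phi> s"
proof (rule extensionalityI[OF f])
  show "shift_lift \<phi> s \<in> extensional (topspace Y)" by (simp add: shift_lift_def)
  fix z assume "z \<in> topspace Y"
  then show "f z = shift_lift \<phi> s z"
    using eq shift_lift_Theta[OF \<phi>] by (elim Theta_cases) simp
qed

lemma shift_lift_Bij: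
  assumes \<phi>: "\<phi> \<in> carrier Aut"
  shows "shift_lift \<phi> s \<in> Bij (topspace Y)"
proof -
  note lift = shift_lift_Theta[OF \<phi>]
  have "inj_on (shift_lift \<phi> s) (topspace Y)"
  proof (rule inj_onI)
    fix z w assume "z \<in> topspace Y" "w \<in> topspace Y" and eq: "shift_lift \<phi> s z = shift_lift \<phi> s w"
    obtain x u where x: "x \<in> C" "z = \<Theta> (x, u)" using \<open>z \<in> topspace Y\<close> by (rule Theta_cases)
    obtain y v where y: "y \<in> C" "w = \<Theta> (y, v)" using \<open>w \<in> topspace Y\<close> by (rule Theta_cases)
    have "\<Theta> (\<phi> x, u + s) = \<Theta> (\<phi> y, v + s)" using eq x y by (simp add: lift)
    then obtain n where n: "\<phi> y = rp n (\<phi> x)" "v + s = u + s - of_int n"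
      by (rule Theta_eqE[OF AutD(4)[OF \<phi> x(1)] AutD(4)[OF \<phi> y(1)]])
    then have "\<phi> y = \<phi> (rp n x)" using Aut_rp[OF \<phi> x(1)] by simp
    then have yx: "y = rp n x"
      using bij_betw_imp_inj_on[OF AutD(2)[OF \<phi>]] y(1) rp_in[OF x(1)] by (metis inj_onD)
    have "w = \<Theta> (x, v + of_int n)" unfolding y(2) yx by (rule Theta_rp[OF x(1)])
    moreover have "v + of_int n = u" using n(2) by simp
    ultimately show "z = w" unfolding x(2) by simp
  qed
  moreover have "shift_lift \<phi> s ` topspace Y = topspace Y"
  proof (intro equalityI subsetI)
    fix w assume "w \<in> shift_lift \<phi> s ` topspace Y"
    then obtain z where "z \<in> topspace Y" "w = shift_lift \<phi> s z" by blast
    then show "w \<in> topspace Y" using AutD(4)[OF \<phi>] by (elim Theta_cases) (simp add: lift)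
  next
    fix w assume "w \<in> topspace Y"
    then obtain y v where y: "y \<in> C" "w = \<Theta> (y, v)" by (rule Theta_cases)
    have "y \<in> \<phi> ` C" using AutD(2)[OF \<phi>] y(1) by (simp add: bij_betw_def)
    then obtain x where x: "y = \<phi> x" "x \<in> C" by (rule imageE)
    have "w = shift_lift \<phi> s (\<Theta> (x, v - s))" using x y by (simp add: lift)
    then show "w \<in> shift_lift \<phi> s ` topspace Y" using Theta_in[OF x(2)] by (rule image_eqI)
  qed
  ultimately show ?thesis by (simp add: Bij_def bij_betw_def shift_lift_def)
qed

text \<open>The coordinate \<open>\<Theta>\<close> maps the compact space \<open>C \<times> [0, 1]\<close> onto a Hausdorff space, so it is a
  quotient map, also after taking the product with an interval of shifts \<open>s\<close>. Continuity may thus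
  be checked for the map \<open>(s, x, u) \<mapsto> \<Theta> (\<phi> x, u + s)\<close>.\<close>

lemma continuous_shift_lift:
  assumes \<phi>: "\<phi> \<in> carrier Aut"
  shows "continuous_map (prod_topology (top_of_set {a..b}) Y) Y (\<lambda>(s, z). shift_lift \<phi> s z)"
proof -
  let ?E = "top_of_set {a..b::real}" and ?I = "top_of_set {0..1::real}"
  let ?K = "prod_topology ?E (prod_topology Cs ?I)"
  have proj: "continuous_map ?K ?E fst" "continuous_map ?K Cs (\<lambda>p. fst (snd p))"
      "continuous_map ?K ?I (\<lambda>p. snd (snd p))"
    using continuous_map_compose[OF continuous_map_snd continuous_map_fst]
      continuous_map_compose[OF continuous_map_snd continuous_map_snd]
    by (auto simp: o_def intro: continuous_map_fst)
  then have real: "continuous_map ?K euclideanreal fst" "continuous_map ?K euclideanreal (\<lambda>p. snd (snd p))"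
    by (simp_all add: continuous_map_in_subtopology)
  let ?q = "\<lambda>p. (fst p, \<Theta> (snd p))"
  have "continuous_map ?K (prod_topology Cs euclideanreal) (\<lambda>p. (fst (snd p), snd (snd p)))"
    using proj(2) real(2) by (rule continuous_map_pairedI)
  from continuous_map_compose[OF this continuous_Theta]
  have "continuous_map ?K Y (\<lambda>p. \<Theta> (snd p))" by (simp add: o_def)
  with proj(1) have q: "continuous_map ?K (prod_topology ?E Y) ?q" by (rule continuous_map_pairedI)
  have "quotient_map ?K (prod_topology ?E Y) ?q"
  proof (rule continuous_imp_quotient_map[OF q])
    show "compact_space ?K"
      using compact_Cs by (simp add: compact_space_prod_topology compact_space_subtopology)
    show "Hausdorff_space (prod_topology ?E Y)"
      using Hausdorff_Y by (simp add: Hausdorff_space_prod_topology Hausdorff_space_subtopology)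
    have "?q ` (A \<times> B) = A \<times> \<Theta> ` B" for A :: "real set" and B by force
    then show "?q ` topspace ?K = topspace (prod_topology ?E Y)"
      using Theta_cover by simp
  qed
  moreover have "continuous_map ?K Y ((\<lambda>(s, z). shift_lift \<phi> s z) \<circ> ?q)"
  proof -
    have "continuous_map ?K Cs (\<lambda>p. \<phi> (fst (snd p)))"
      using continuous_map_compose[OF proj(2) AutD(3)[OF \<phi>]] by (simp add: o_def)
    moreover have "continuous_map ?K euclideanreal (\<lambda>p. snd (snd p) + fst p)"
      using real by (intro continuous_map_add)
    ultimately have "continuous_map ?K (prod_topology Cs euclideanreal) (\<lambda>p. (\<phi> (fst (snd p)), snd (snd p) + fst p))"
      by (rule continuous_map_pairedI)
    from continuous_map_compose[OF this continuous_Theta]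
    have "continuous_map ?K Y (\<lambda>p. \<Theta> (\<phi> (fst (snd p)), snd (snd p) + fst p))" by (simp add: o_def)
    then show ?thesis
      by (rule continuous_map_eq) (auto simp: shift_lift_Theta[OF \<phi>])
  qed
  ultimately show ?thesis by (rule continuous_compose_quotient_map)
qed

text \<open>In the time coordinates of the leaves of \<open>y \<in> C\<close> and \<open>\<phi> y\<close> the map is \<open>L (\<phi> y)\<close> after the
  translation by \<open>s\<close> after the inverse of \<open>L y\<close>.\<close>

lemma leafwise_shift_lift:
  assumes \<phi>: "\<phi> \<in> carrier Aut"
  shows "leafwise (shift_lift \<phi> s)"
  unfolding leafwise_def
proof
  fix x assume "x \<in> topspace X"
  then obtain y i where y: "y \<in> C" "x = (T ^^ i) y" using X_eq by blast
  note Ly = L_strict_mono[OF y(1)] L_surj[OF y(1)]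
  have \<phi>y: "\<phi> y \<in> C" using AutD(4)[OF \<phi> y(1)] .
  define h where "h t = L (\<phi> y) (inv_into UNIV (L y) (t + real i) + s)" for t
  have "shift_lift \<phi> s (cls (x, t)) = cls (\<phi> y, h t)" for t
  proof -
    have "cls (x, t) = cls (y, t + real i)"
      using cls_zpow[OF C_in[OF y(1)], of "int i" t] y by (simp add: zpow_of_nat)
    also have "\<dots> = \<Theta> (y, inv_into UNIV (L y) (t + real i))"
      using Ly(2) by (simp add: \<Theta>_def f_inv_into_f)
    finally show ?thesis using shift_lift_Theta[OF \<phi> y(1)] by (simp add: \<Theta>_def h_def)
  qed
  moreover have "strict_mono h"
    unfolding h_def using inv_reparam(1)[OF Ly] L_strict_mono[OF \<phi>y] by (simp add: strict_mono_def)
  moreover have "surj h"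
  proof -
    have "\<exists>t. h t = r" for r
    proof -
      obtain v where "r = L (\<phi> y) v" using L_surj[OF \<phi>y] by (metis surjE)
      then have "h (L y (v - s) - real i) = r"
        unfolding h_def using Ly(1) by (simp add: strict_mono_imp_inj_on)
      then show ?thesis by blast
    qed
    then show ?thesis by (metis surj_def)
  qed
  ultimately show "\<exists>y\<in>topspace X. \<exists>h::real \<Rightarrow> real. strict_mono h \<and> surj h \<and>
      (\<forall>t. shift_lift \<phi> s (cls (x, t)) = cls (y, h t))"
    using C_in[OF \<phi>y] by blast
qed

lemma shift_lift_in_Homeo_plus:
  assumes \<phi>: "\<phi> \<in> carrier Aut"
  shows "shift_lift \<phi> s \<in> carrier (Homeo_plus X T)"
proof -
  have "continuous_map Y (prod_topology (top_of_set {s..s}) Y) (\<lambda>z. (s, z))"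
    by (intro continuous_map_pairedI) simp_all
  from continuous_map_compose[OF this continuous_shift_lift[OF \<phi>]]
  have "continuous_map Y Y (shift_lift \<phi> s)" by (simp add: o_def)
  then show ?thesis
    using shift_lift_Bij[OF \<phi>] leafwise_shift_lift[OF \<phi>] by (simp add: carrier_Homeo_plus)
qed

text \<open>For \<open>0 \<le> u \<le> 1\<close> the point \<open>\<Theta> (x, u)\<close> divides the segment over \<open>x\<close> in the ratio \<open>u : 1 - u\<close>,
  and linear maps between segments preserve ratios.\<close>

lemma suspend_eq_shift_lift:
  assumes \<phi>: "\<phi> \<in> carrier Aut"
  shows "suspend X T C \<phi> = shift_lift \<phi> 0"
proof (rule extensionalityI)
  show "suspend X T C \<phi> \<in> extensional (topspace Y)" "shift_lift \<phi> 0 \<in> extensional (topspace Y)"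
    by (simp_all add: suspend_def shift_lift_def)
  have param: "cls (x, t) = \<Theta> (x, t / real (r x))"
    "cls (\<phi> x, t * real (r (\<phi> x)) / real (r x)) = shift_lift \<phi> 0 (\<Theta> (x, t / real (r x)))"
    if "x \<in> C" "0 \<le> t" "t \<le> real (r x)" for x t
  proof -
    have r: "real (r x) > 0" using r_ge_1[OF that(1)] by simp
    then have "0 \<le> t / real (r x)" "t / real (r x) \<le> 1" using that by simp_all
    note unit = L_unit[OF _ this]
    show "cls (x, t) = \<Theta> (x, t / real (r x))"
      using unit[OF that(1)] r by (simp add: \<Theta>_def)
    show "cls (\<phi> x, t * real (r (\<phi> x)) / real (r x)) = shift_lift \<phi> 0 (\<Theta> (x, t / real (r x)))"
      using unit[OF AutD(4)[OF \<phi> that(1)]] shift_lift_Theta[OF \<phi> that(1)] by (simp add: \<Theta>_def)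
  qed
  fix z assume z: "z \<in> topspace Y"
  then obtain x u where x: "x \<in> C" "0 \<le> u" "u \<le> 1" "z = \<Theta> (x, u)" by (rule Theta_cases)
  have r: "real (r x) > 0" using r_ge_1[OF x(1)] by simp
  have t: "0 \<le> u * real (r x)" "u * real (r x) \<le> real (r x)" using x by (simp_all add: mult_left_le_one_le)
  have "(THE w. \<exists>x t. x \<in> C \<and> 0 \<le> t \<and> t \<le> real (r x) \<and> z = cls (x, t) \<and>
      w = cls (\<phi> x, t * real (r (\<phi> x)) / real (r x))) = shift_lift \<phi> 0 z"
  proof (rule the_equality)
    show "\<exists>x t. x \<in> C \<and> 0 \<le> t \<and> t \<le> real (r x) \<and> z = cls (x, t) \<and>
      shift_lift \<phi> 0 z = cls (\<phi> x, t * real (r (\<phi> x)) / real (r x))"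
      using param[OF x(1) t] x(1,4) r t by (intro exI[of _ x] exI[of _ "u * real (r x)"]) simp
    show "w = shift_lift \<phi> 0 z" if "\<exists>x t. x \<in> C \<and> 0 \<le> t \<and> t \<le> real (r x) \<and> z = cls (x, t) \<and>
      w = cls (\<phi> x, t * real (r (\<phi> x)) / real (r x))" for w
      using that param by metis
  qed
  then show "suspend X T C \<phi> z = shift_lift \<phi> 0 z" using z by (simp add: suspend_def)
qed

section \<open>The homomorphism and its kernel\<close>

lemma suspend_hom: "suspend X T C \<in> hom Aut (Homeo_plus X T)"
proof (rule homI)
  show "suspend X T C \<phi> \<in> carrier (Homeo_plus X T)" if "\<phi> \<in> carrier Aut" for \<phi>
    using that by (simp add: suspend_eq_shift_lift shift_lift_in_Homeo_plus)
  fix \<phi> \<psi> assume \<phi>: "\<phi> \<in> carrier Aut" and \<psi>: "\<psi> \<in> carrier Aut"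
  have prod: "\<phi> \<otimes>\<^bsub>Aut\<^esub> \<psi> \<in> carrier Aut"
    using Aut_group_Aut \<phi> \<psi> by (simp add: group.is_monoid monoid.m_closed)
  have "compose (topspace Y) (shift_lift \<phi> 0) (shift_lift \<psi> 0) = shift_lift (\<phi> \<otimes>\<^bsub>Aut\<^esub> \<psi>) 0"
  proof (rule shift_lift_eqI[OF prod])
    fix x u assume x: "x \<in> C"
    have "(\<phi> \<otimes>\<^bsub>Aut\<^esub> \<psi>) x = \<phi> (\<psi> x)" using x by (simp add: mult_Aut_group[OF \<phi> \<psi>] compose_def)
    then show "compose (topspace Y) (shift_lift \<phi> 0) (shift_lift \<psi> 0) (\<Theta> (x, u))
        = \<Theta> ((\<phi> \<otimes>\<^bsub>Aut\<^esub> \<psi>) x, u + 0)"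
      using x AutD(4)[OF \<psi> x] by (simp add: compose_def shift_lift_Theta \<phi> \<psi>)
  qed simp
  then show "suspend X T C (\<phi> \<otimes>\<^bsub>Aut\<^esub> \<psi>) = suspend X T C \<phi> \<otimes>\<^bsub>Homeo_plus X T\<^esub> suspend X T C \<psi>"
    using \<phi> \<psi> prod by (simp add: suspend_eq_shift_lift mult_Homeo_plus shift_lift_in_Homeo_plus)
qed

lemma Psi_group_hom: "group_hom Aut (mapping_class_group X T) (Psi X T C)"
proof -
  have "Psi X T C = isotopy_class X T \<circ> suspend X T C" by (simp add: Psi_def fun_eq_iff)
  then have "Psi X T C \<in> hom Aut (mapping_class_group X T)"
    using Group.hom_compose[OF suspend_hom isotopy_class_hom] by simp
  then show ?thesis
    by (simp add: group_hom_def group_hom_axioms_def Aut_group_Aut mapping_class_group_group)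
qed

lemma Aut_pow:
  assumes x: "x \<in> C"
  shows "(R [^]\<^bsub>Aut\<^esub> (n::int)) x = rp n x"
proof -
  interpret Aut: group Aut by (rule Aut_group_Aut)
  have pow: "R [^]\<^bsub>Aut\<^esub> k \<in> carrier Aut" for k :: int using R_in_Aut by simp
  have "(R [^]\<^bsub>Aut\<^esub> (k + 1)) x = R ((R [^]\<^bsub>Aut\<^esub> k) x)" for k :: int
  proof -
    have "R [^]\<^bsub>Aut\<^esub> (1 + k) = R \<otimes>\<^bsub>Aut\<^esub> (R [^]\<^bsub>Aut\<^esub> k)"
      using Aut.int_pow_mult[OF R_in_Aut, of 1 k] R_in_Aut by simp
    then show ?thesis
      using x by (simp add: add.commute mult_Aut_group[OF R_in_Aut pow] compose_def)
  qed
  then have "(R [^]\<^bsub>Aut\<^esub> n) x = rp n ((R [^]\<^bsub>Aut\<^esub> (0::int)) x)"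
    using AutD(4)[OF pow x] by (intro zpow_eqI[OF bij_R]) simp_all
  also have "(R [^]\<^bsub>Aut\<^esub> (0::int)) x = x" using x by (simp add: one_Aut_group)
  finally show ?thesis .
qed

text \<open>The flow of the suspension of \<open>R\<close> joins the identity to its time-one map, which is
  \<open>\<Theta> (x, u) \<mapsto> \<Theta> (x, u + 1) = \<Theta> (R x, u)\<close>.\<close>

lemma R_isotopic_identity: "Psi X T C R = \<one>\<^bsub>mapping_class_group X T\<^esub>"
proof -
  interpret hom: group_hom Aut "mapping_class_group X T" "Psi X T C" by (rule Psi_group_hom)
  have one: "\<one>\<^bsub>Aut\<^esub> \<in> carrier Aut" by simp
  have path: "path_component_of HT (shift_lift \<one>\<^bsub>Aut\<^esub> 0) (shift_lift \<one>\<^bsub>Aut\<^esub> 1)"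
    using shift_lift_in_Homeo_plus[OF one] continuous_shift_lift[OF one] by (rule isotopicI)
  have "shift_lift R 0 = shift_lift \<one>\<^bsub>Aut\<^esub> 1"
  proof (rule shift_lift_eqI[OF one])
    fix x u assume x: "x \<in> C"
    have "\<Theta> (R x, u) = \<Theta> (x, u + 1)" using Theta_rp[OF x, of 1 u] by simp
    then show "shift_lift R 0 (\<Theta> (x, u)) = \<Theta> (\<one>\<^bsub>Aut\<^esub> x, u + 1)"
      using x shift_lift_Theta[OF R_in_Aut x] by (simp add: one_Aut_group)
  qed (simp add: shift_lift_def)
  then have "Psi X T C \<one>\<^bsub>Aut\<^esub> = Psi X T C R"
    unfolding Psi_def suspend_eq_shift_lift[OF one] suspend_eq_shift_lift[OF R_in_Aut]
    using isotopy_class_eq[OF path] by simp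
  then show ?thesis using hom.hom_one by simp
qed

text \<open>The exponent \<open>k\<close> is read off at one point \<open>x0\<close> of \<open>C\<close> with a dense \<open>T\<close>-orbit. The points where
  \<open>\<phi>\<close> and \<open>R\<^sup>k\<close> differ form an open subset of \<open>C\<close>, hence of \<open>X\<close>. If it were not empty it would
  meet the orbit of \<open>x0\<close>, and in a point of \<open>C\<close>, that is in some \<open>R\<^sup>l x0\<close>; there \<open>\<phi>\<close> agrees with
  \<open>R\<^sup>k\<close> because both commute with \<open>R\<^sup>l\<close>.\<close>

lemma commuting_eq_iterate:
  assumes tr: "topologically_transitive X T" and \<phi>: "\<phi> \<in> carrier Aut"
    and orb: "\<And>x. x \<in> C \<Longrightarrow> \<exists>n. \<phi> x = rp n x"
  shows "\<exists>k. \<forall>x\<in>C. \<phi> x = rp k x"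
proof -
  obtain x1 where x1: "x1 \<in> topspace X" "X closure_of range (\<lambda>n. zpow X T n x1) = topspace X"
    using tr unfolding topologically_transitive_def by blast
  then obtain x0 i where x0: "x0 \<in> C" "x1 = (T ^^ i) x0" using X_eq by blast
  obtain k where k: "\<phi> x0 = rp k x0" using orb[OF x0(1)] by blast
  have "continuous_map Cs Cs (rp k)" by (rule continuous_map_zpow[OF homeo_R])
  then have "closedin Cs {x \<in> topspace Cs. \<phi> x = rp k x}"
    by (rule closedin_continuous_maps_eq[OF Hausdorff_Cs AutD(3)[OF \<phi>]])
  then have "openin Cs (topspace Cs - {x \<in> topspace Cs. \<phi> x = rp k x})"
    by (simp only: closedin_def)
  then have open_neq: "openin X (C - {x \<in> C. \<phi> x = rp k x})"
    using C_open by (simp add: openin_open_subtopology)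
  have "\<phi> x = rp k x" if x: "x \<in> C" for x
  proof (rule ccontr)
    assume "\<phi> x \<noteq> rp k x"
    then have x_neq: "x \<in> C - {x \<in> C. \<phi> x = rp k x}" using x by simp
    have "x \<in> X closure_of range (\<lambda>n. zpow X T n x1)" using x1 x by simp
    then have "\<forall>V. x \<in> V \<and> openin X V \<longrightarrow> (\<exists>y. y \<in> range (\<lambda>n. zpow X T n x1) \<and> y \<in> V)"
      unfolding in_closure_of by (rule conjunct2)
    from this[rule_format, OF conjI[OF x_neq open_neq]]
    have "\<exists>n. zpow X T n x1 \<in> C - {x \<in> C. \<phi> x = rp k x}" by blast
    then obtain n where n: "zpow X T n x1 \<in> C" "\<phi> (zpow X T n x1) \<noteq> rp k (zpow X T n x1)"
      by auto
    have "zpow X T n x1 = zpow X T (n + int i) x0"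
      using zpow_add[OF bij C_in[OF x0(1)], of n "int i"] x0 by (simp add: zpow_of_nat)
    then obtain l where l: "zpow X T n x1 = rp l x0"
      using zpow_is_rp[OF x0(1), of "n + int i"] n(1) by auto
    have "\<phi> (rp l x0) = rp l (rp k x0)" using Aut_rp[OF \<phi> x0(1)] k by simp
    also have "\<dots> = rp (l + k) x0" by (rule rp_add[OF x0(1), symmetric])
    also have "l + k = k + l" by simp
    also have "rp (k + l) x0 = rp k (rp l x0)" by (rule rp_add[OF x0(1)])
    finally show False using n(2) unfolding l by simp
  qed
  then show ?thesis by blast
qed

text \<open>Evaluating an isotopy from the identity to \<open>S\<^sub>\<phi>\<close> at the point \<open>(x, 0)\<close> of the suspension, with
  \<open>x \<in> C\<close>, gives a path to \<open>(\<phi> x, 0)\<close>. It stays in a leaf, so \<open>\<phi> x\<close> is on the \<open>T\<close>-orbit of \<open>x\<close>.\<close>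

lemma kernel_Psi:
  assumes tr: "topologically_transitive X T"
  shows "kernel Aut (mapping_class_group X T) (Psi X T C) = generate Aut {R}"
proof
  interpret hom: group_hom Aut "mapping_class_group X T" "Psi X T C" by (rule Psi_group_hom)
  show "generate Aut {R} \<subseteq> kernel Aut (mapping_class_group X T) (Psi X T C)"
    using R_in_Aut R_isotopic_identity
    by (intro group.generate_subgroup_incl[OF Aut_group_Aut _ hom.subgroup_kernel]) (simp add: kernel_def)
  show "kernel Aut (mapping_class_group X T) (Psi X T C) \<subseteq> generate Aut {R}"
  proof
    fix \<phi> assume ker: "\<phi> \<in> kernel Aut (mapping_class_group X T) (Psi X T C)"
    have one: "\<one>\<^bsub>Aut\<^esub> \<in> carrier Aut" by simp
    from ker have \<phi>: "\<phi> \<in> carrier Aut" and "Psi X T C \<phi> = Psi X T C \<one>\<^bsub>Aut\<^esub>"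
      by (simp_all add: kernel_def)
    then have "isotopy_class X T (shift_lift \<one>\<^bsub>Aut\<^esub> 0) = isotopy_class X T (shift_lift \<phi> 0)"
      by (simp add: Psi_def suspend_eq_shift_lift)
    moreover have "shift_lift \<phi> 0 \<in> isotopy_class X T (shift_lift \<phi> 0)"
      using shift_lift_in_Homeo_plus[OF \<phi>] by (simp add: isotopy_class_def path_component_of_refl topspace_HT)
    ultimately have "shift_lift \<phi> 0 \<in> isotopy_class X T (shift_lift \<one>\<^bsub>Aut\<^esub> 0)" by simp
    then have iso: "path_component_of HT (shift_lift \<one>\<^bsub>Aut\<^esub> 0) (shift_lift \<phi> 0)"
      by (simp add: isotopy_class_def)
    have "\<exists>n. \<phi> x = rp n x" if x: "x \<in> C" for x
    proof -
      have "path_component_of Y (shift_lift \<one>\<^bsub>Aut\<^esub> 0 (\<Theta> (x, 0))) (shift_lift \<phi> 0 (\<Theta> (x, 0)))"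
        using path_component_of_continuous_image[OF continuous_map_eval[OF Theta_in[OF x]] iso] .
      then have "path_component_of Y (\<Theta> (x, 0)) (\<Theta> (\<phi> x, 0))"
        using shift_lift_Theta[OF one x, of 0 0] shift_lift_Theta[OF \<phi> x, of 0 0] x
        by (simp add: one_Aut_group)
      then have "leaf (\<Theta> (x, 0)) = leaf (\<Theta> (\<phi> x, 0))" by (rule path_component_in_leaf)
      then obtain m where "\<phi> x = zpow X T m x"
        unfolding \<Theta>_def using same_leaf_imp_orbit x AutD(4)[OF \<phi> x] by (metis C_in fst_conv)
      then show ?thesis using zpow_is_rp[OF x, of m] AutD(4)[OF \<phi> x] by auto
    qed
    then obtain k where k: "\<And>x. x \<in> C \<Longrightarrow> \<phi> x = rp k x"
      using commuting_eq_iterate[OF tr \<phi>] by blast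
    have "R [^]\<^bsub>Aut\<^esub> k \<in> carrier Aut" using R_in_Aut by simp
    then have "\<phi> = R [^]\<^bsub>Aut\<^esub> k"
      using k Aut_pow by (intro extensionalityI[OF AutD(1)[OF \<phi>] AutD(1)]) simp_all
    then show "\<phi> \<in> generate Aut {R}" using group.generate_pow[OF Aut_group_Aut R_in_Aut] by blast
  qed
qed

end

section \<open>The embedding of the automorphism group\<close>

lemma discrete_cross_section_topspace:
  assumes "\<And>x. x \<in> topspace X \<Longrightarrow> T x \<in> topspace X"
  shows "discrete_cross_section X T (topspace X)"
    "return_map T (topspace X) = restrict T (topspace X)"
proof -
  have rt: "return_time T (topspace X) x = 1" if "x \<in> topspace X" for x
    unfolding return_time_def
  proof (rule Least_equality)
    show "1 \<le> (1::nat) \<and> (T ^^ 1) x \<in> topspace X" using assms[OF that] by simp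
  qed simp
  show "return_map T (topspace X) = restrict T (topspace X)"
    unfolding return_map_def using rt by (intro restrict_ext) simp
  have cont: "continuous_map X (discrete_topology UNIV) (return_time T (topspace X))"
    by (rule continuous_map_eq[of X _ "\<lambda>_. 1"]) (simp_all add: rt)
  have pow: "(T ^^ i) x \<in> topspace X" if "x \<in> topspace X" for x i
    by (induction i) (simp_all add: that assms)
  have ret: "\<exists>i\<ge>1. (T ^^ i) x \<in> topspace X" if "x \<in> topspace X" for x
    using assms[OF that] by (intro exI[of _ 1]) simp
  have orbits: "topspace X = {(T ^^ i) x |x i. x \<in> topspace X}" (is "_ = ?B")
  proof (intro equalityI subsetI)
    fix x assume "x \<in> topspace X"
    then have "x = (T ^^ 0) x \<and> x \<in> topspace X" by simp
    then show "x \<in> ?B" unfolding mem_Collect_eq by (intro exI)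
  next
    fix y assume "y \<in> ?B"
    then obtain x i where "y = (T ^^ i) x" "x \<in> topspace X" unfolding mem_Collect_eq by (elim exE conjE)
    then show "y \<in> topspace X" using pow[of x i] by simp
  qed
  show "discrete_cross_section X T (topspace X)"
    unfolding discrete_cross_section_def subtopology_topspace
  proof (intro conjI)
    show "\<forall>x\<in>topspace X. \<exists>i\<ge>1. (T ^^ i) x \<in> topspace X" using ret by (rule ballI)
  qed (rule openin_topspace closedin_topspace cont orbits)+
qed

theorem proposition3p2:
  fixes X :: "'a topology" and T :: "'a \<Rightarrow> 'a"
  assumes "Cantor_system X T" and "aperiodic X T" and "topologically_transitive X T"
  shows
    "(\<forall>C. discrete_cross_section X T C \<longrightarrow>
        group_hom (Aut_group (subtopology X C) (return_map T C)) (mapping_class_group X T) (Psi X T C) \<and>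
        kernel (Aut_group (subtopology X C) (return_map T C)) (mapping_class_group X T) (Psi X T C)
          = generate (Aut_group (subtopology X C) (return_map T C)) {return_map T C}) \<and>
     generate (Aut_group X T) {restrict T (topspace X)} \<lhd> Aut_group X T \<and>
     (\<exists>\<iota> \<in> mon (Aut_group X T Mod generate (Aut_group X T) {restrict T (topspace X)})
                (mapping_class_group X T).
        \<forall>\<phi>\<in>carrier (Aut_group X T).
          \<iota> (generate (Aut_group X T) {restrict T (topspace X)} #>\<^bsub>Aut_group X T\<^esub> \<phi>)
            = Psi X T (topspace X) \<phi>)"
proof -
  interpret aperiodic_system X T using assms by (simp add: aperiodic_system_def)
  have main: "group_hom (Aut_group (subtopology X C) (return_map T C)) (mapping_class_group X T) (Psi X T C)"
    "kernel (Aut_group (subtopology X C) (return_map T C)) (mapping_class_group X T) (Psi X T C)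
          = generate (Aut_group (subtopology X C) (return_map T C)) {return_map T C}"
    if "discrete_cross_section X T C" for C
  proof -
    interpret cross_section X T C using that by unfold_locales
    show "group_hom (Aut_group (subtopology X C) (return_map T C)) (mapping_class_group X T) (Psi X T C)"
      by (rule Psi_group_hom)
    show "kernel (Aut_group (subtopology X C) (return_map T C)) (mapping_class_group X T) (Psi X T C)
          = generate (Aut_group (subtopology X C) (return_map T C)) {return_map T C}"
      by (rule kernel_Psi[OF assms(3)])
  qed
  let ?A = "Aut_group X T" and ?N = "generate (Aut_group X T) {restrict T (topspace X)}"
  let ?M = "mapping_class_group X T" and ?\<Psi> = "Psi X T (topspace X)"
  have "Aut_group (subtopology X (topspace X)) (return_map T (topspace X)) = ?A"
  proof -
    have "f (restrict T (topspace X) x) = restrict T (topspace X) (f x) \<longleftrightarrow> f (T x) = T (f x)"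
      if "f \<in> Bij (topspace X)" "x \<in> topspace X" for f x
      using Bij_imp_funcset[OF that(1)] that(2) by auto
    then have "{f \<in> Bij (topspace X). homeomorphic_map X X f \<and>
          (\<forall>x\<in>topspace X. f (restrict T (topspace X) x) = restrict T (topspace X) (f x))}
        = {f \<in> Bij (topspace X). homeomorphic_map X X f \<and> (\<forall>x\<in>topspace X. f (T x) = T (f x))}"
      by blast
    then show ?thesis
      by (simp add: Aut_group_def subtopology_topspace discrete_cross_section_topspace(2)[OF T_in]
          del: restrict_apply)
  qed
  then have hom: "group_hom ?A ?M ?\<Psi>" and ker: "kernel ?A ?M ?\<Psi> = ?N"
    using main[OF discrete_cross_section_topspace(1)[OF T_in]]
    by (simp_all add: discrete_cross_section_topspace(2)[OF T_in])
  interpret hom: group_hom ?A ?M ?\<Psi> by (rule hom)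
  let ?\<iota> = "\<lambda>N. the_elem (?\<Psi> ` N)"
  have normal: "?N \<lhd> ?A" using hom.normal_kernel ker by simp
  have mon: "?\<iota> \<in> mon (?A Mod ?N) ?M"
    using hom.FactGroup_hom hom.FactGroup_inj_on ker by (simp add: mon_def)
  have induced: "?\<iota> (?N #>\<^bsub>?A\<^esub> \<phi>) = ?\<Psi> \<phi>" if \<phi>: "\<phi> \<in> carrier ?A" for \<phi>
  proof -
    show ?thesis
    proof (rule the_elem_image_unique)
      have "subgroup ?N ?A" using hom.subgroup_kernel ker by simp
      then show "?N #>\<^bsub>?A\<^esub> \<phi> \<noteq> {}" using hom.G.rcos_self[OF \<phi>] by blast
      fix y assume "y \<in> ?N #>\<^bsub>?A\<^esub> \<phi>"
      then obtain \<nu> where \<nu>: "\<nu> \<in> kernel ?A ?M ?\<Psi>" "y = \<nu> \<otimes>\<^bsub>?A\<^esub> \<phi>"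
        unfolding ker r_coset_def by blast
      then show "?\<Psi> y = ?\<Psi> \<phi>" using \<phi> by (simp add: kernel_def)
    qed
  qed
  show ?thesis
    by (intro conjI allI impI bexI[of _ ?\<iota>] ballI main normal mon induced)
qed

end
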